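(* Let $\mathcal{A}$ be a multiarrangement of linear hyperplanes in $\mathbb{C}^n$ of rank $r$ and size $m$ (counted with multiplicity). Let $I_{\mathcal{A}}\subseteq\Omega_n$ be the superspace ideal of $\mathcal{A}$ and let $\mathcal{E}_{\mathcal{A}}=\Omega_n/I_{\mathcal{A}}$. Then the bigraded Hilbert series of $\mathcal{E}_{\mathcal{A}}$ is $$\operatorname{Hilb}(\mathcal{E}_{\mathcal{A}};q,t)=(1+t)^r\,q^{m-r}\,T_{\mathcal{A}}\!\left(\frac{1+q+t}{1+t},\frac1q\right),$$ where $q$ tracks bosonic degree and $t$ tracks fermionic degree.
   Context: Superspace: $\Omega_n=\mathbb{C}[x_1,\dots,x_n]\otimes\wedge\{\theta_1,\dots,\theta_n\}$, where the $x_i$ commute and the $\theta_i$ anticommute. It is bigraded: $x_i$ has degree $(1,0)$ (bosonic) and $\theta_i$ has degree $(0,1)$ (fermionic). The Euler operator $d:\Omega_n\to\Omega_n$ is $df=\sum_{i=1}^n(\partial f/\partial x_i)\cdot\theta_i$, with $\theta$-variables treated as constants in $\partial/\partial x_i$. Multiarrangement: a finite collection $\mathcal{A}=\{H_1,\dots,H_m\}$ of linear hyperplanes (codimension one subspaces) of $\mathbb{C}^n$ with repeats allowed; its size is $m$. Its rank $r$ is the dimension of the span of the normal linear forms $\alpha_{H_1},\dots,\alpha_{H_m}$ (where $\alpha_H$ is a nonzero linear form with zero set $H$); the rank $\mathsf{rk}(A)$ of a subcollection $A\subseteq\mathcal{A}$ is defined similarly. For a line $L=\mathbb{C}\cdot(\ell_1,\dots,\ell_n)$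 through the origin in $\mathbb{C}^n$ put $\lambda_L=\ell_1x_1+\cdots+\ell_nx_n$ (defined up to a nonzero scalar) and $\rho_{\mathcal{A}}(L)=\#\{1\le i\le m: L\not\subseteq H_i\}$. The ideal is $$I_{\mathcal{A}}=\left(\lambda_L^{\rho_{\mathcal{A}}(L)+1},\ d\big(\lambda_L^{\rho_{\mathcal{A}}(L)+1}\big)\ :\ L\subseteq\mathbb{C}^n\text{ a line}\right)\subseteq\Omega_n,$$ which is bihomogeneous. For a bigraded vector space $V=\bigoplus_{i,j\ge0}V_{i,j}$ with finite-dimensional pieces, $\operatorname{Hilb}(V;q,t)=\sum_{i,j}\dim_{\mathbb{C}}(V_{i,j})q^it^j$, where $i$ is bosonic and $j$ is fermionic degree. Tutte polynomial: $T_{\mathcal{A}}(x,y)=\sum_{A\subseteq\mathcal{A}}(x-1)^{r-\mathsf{rk}(A)}(y-1)^{|A|-\mathsf{rk}(A)}$, the sum being over all subcollections (elements with multiplicity regarded as distinct). *)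

theory Defs
  imports
    "HOL-Analysis.Cartesian_Space"
    "HOL-Library.Poly_Mapping"
    "HOL-Computational_Algebra.Formal_Laurent_Series"
    "HOL-Algebra.QuotRing"
    "HOL-Algebra.Embedded_Algebras"
begin

section \<open>Superspace\<close>

text \<open>
  The polynomial ring in commuting variables indexed by \<open>'n\<close>: finitely supported maps from exponent
  vectors to complex coefficients, with the convolution product of \<^theory>\<open>HOL-Library.Poly_Mapping\<close>.
\<close>

type_synonym 'n cpoly = "('n \<Rightarrow>\<^sub>0 nat) \<Rightarrow>\<^sub>0 complex"

text \<open>
  Superspace is the free module over the polynomial ring with basis the monomials
  \<open>\<theta>\<^sub>S = \<theta>\<^bsub>s\<^sub>1\<^esub> \<cdots> \<theta>\<^bsub>s\<^sub>k\<^esub>\<close> for \<open>S = {s\<^sub>1 < \<dots> < s\<^sub>k}\<close>; an element is its family of coefficients \<open>(f\<^sub>S)\<^sub>S\<close>.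
\<close>

typedef 'n superspace = "UNIV :: ('n set \<Rightarrow> 'n cpoly) set"
  morphisms theta_coeff Superspace ..

setup_lifting type_definition_superspace

text \<open>
  \<open>\<theta>\<^sub>S \<theta>\<^sub>T = theta_sign S T \<cdot> \<theta>\<^bsub>S \<union> T\<^esub>\<close> for disjoint \<open>S\<close> and \<open>T\<close> (and it is \<open>0\<close> otherwise): the exponent counts
  the transpositions that sort the concatenated word.
\<close>

definition theta_sign :: "'n::{finite,linorder} set \<Rightarrow> 'n set \<Rightarrow> 'n cpoly" where
  "theta_sign S T = (- 1) ^ card {(s, t). s \<in> S \<and> t \<in> T \<and> t < s}"

lemma theta_sign_empty [simp]: "theta_sign {} T = 1" "theta_sign S {} = 1"
  by (simp_all add: theta_sign_def)

lemma theta_sign_Un_left: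
  assumes "S \<inter> T = {}"
  shows "theta_sign (S \<union> T) W = theta_sign S W * theta_sign T W"
proof -
  have "{(s, t). s \<in> S \<union> T \<and> t \<in> W \<and> t < s}
      = {(s, t). s \<in> S \<and> t \<in> W \<and> t < s} \<union> {(s, t). s \<in> T \<and> t \<in> W \<and> t < s}"
    by auto
  moreover have "card \<dots> = card {(s, t). s \<in> S \<and> t \<in> W \<and> t < s} + card {(s, t). s \<in> T \<and> t \<in> W \<and> t < s}"
    using assms by (intro card_Un_disjoint) auto
  ultimately show ?thesis by (simp add: theta_sign_def power_add)
qed

lemma theta_sign_Un_right:
  assumes "T \<inter> W = {}"
  shows "theta_sign S (T \<union> W) = theta_sign S T * theta_sign S W"
proof -
  have "{(s, t). s \<in> S \<and> t \<in> T \<union> W \<and> t < s}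
      = {(s, t). s \<in> S \<and> t \<in> T \<and> t < s} \<union> {(s, t). s \<in> S \<and> t \<in> W \<and> t < s}"
    by auto
  moreover have "card \<dots> = card {(s, t). s \<in> S \<and> t \<in> T \<and> t < s} + card {(s, t). s \<in> S \<and> t \<in> W \<and> t < s}"
    using assms by (intro card_Un_disjoint) auto
  ultimately show ?thesis by (simp add: theta_sign_def power_add)
qed

instantiation superspace :: (type) ab_group_add
begin

lift_definition zero_superspace :: "'a superspace" is "\<lambda>_. 0" .
lift_definition plus_superspace :: "'a superspace \<Rightarrow> 'a superspace \<Rightarrow> 'a superspace"
  is "\<lambda>f g U. f U + g U" .
lift_definition minus_superspace :: "'a superspace \<Rightarrow> 'a superspace \<Rightarrow> 'a superspace"
  is "\<lambda>f g U. f U - g U" .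
lift_definition uminus_superspace :: "'a superspace \<Rightarrow> 'a superspace"
  is "\<lambda>f U. - f U" .

instance by standard (transfer, simp add: fun_eq_iff algebra_simps)+

end

instantiation superspace :: ("{finite, linorder}") ring_1
begin

lift_definition one_superspace :: "'a superspace" is "\<lambda>U. if U = {} then 1 else 0" .

lift_definition times_superspace :: "'a superspace \<Rightarrow> 'a superspace \<Rightarrow> 'a superspace"
  is "\<lambda>f g U. \<Sum>S\<in>Pow U. theta_sign S (U - S) * f S * g (U - S)" .

instance
proof
  fix f g h :: "'a superspace"
  show "f * g * h = f * (g * h)"
  proof (transfer, rule ext)
    fix f g h :: "'a set \<Rightarrow> 'a cpoly" and U :: "'a set"
    have "(\<Sum>S\<in>Pow U. theta_sign S (U - S) * (\<Sum>T\<in>Pow S. theta_sign T (S - T) * f T * g (S - T)) * h (U - S))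
      = (\<Sum>(S, T)\<in>Sigma (Pow U) Pow.
          theta_sign S (U - S) * (theta_sign T (S - T) * f T * g (S - T)) * h (U - S))"
      by (subst sum.Sigma [symmetric]) (auto simp: sum_distrib_left sum_distrib_right)
    also have "\<dots> = (\<Sum>(S, T)\<in>Sigma (Pow U) (\<lambda>S. Pow (U - S)).
          theta_sign S (U - S) * f S * (theta_sign T (U - S - T) * g T * h (U - S - T)))"
    proof (rule sum.reindex_bij_witness
        [where j = "\<lambda>(S, T). (T, S - T)" and i = "\<lambda>(S, T). (S \<union> T, S)"], goal_cases)
      case (5 p)
      obtain S T where p: "p = (S, T)" by fastforce
      have sub: "T \<subseteq> S" "S \<subseteq> U" using 5 p by auto
      have e1: "theta_sign S (U - S) = theta_sign T (U - S) * theta_sign (S - T) (U - S)"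
        using theta_sign_Un_left [of T "S - T" "U - S"] sub by (simp add: Un_absorb1)
      have "U - T = (S - T) \<union> (U - S)" using sub by auto
      then have e2: "theta_sign T (U - T) = theta_sign T (S - T) * theta_sign T (U - S)"
        using theta_sign_Un_right [of "S - T" "U - S" T] by auto
      have e3: "U - T - (S - T) = U - S" using sub by auto
      show ?case by (simp only: p prod.case e1 e2 e3 ac_simps)
    qed auto
    also have "\<dots> = (\<Sum>S\<in>Pow U. theta_sign S (U - S) * f S *
        (\<Sum>T\<in>Pow (U - S). theta_sign T (U - S - T) * g T * h (U - S - T)))"
      by (subst sum.Sigma [symmetric]) (auto simp: sum_distrib_left)
    finally show "(\<Sum>S\<in>Pow U. theta_sign S (U - S) *
          (\<Sum>T\<in>Pow S. theta_sign T (S - T) * f T * g (S - T)) * h (U - S))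
      = (\<Sum>S\<in>Pow U. theta_sign S (U - S) * f S *
        (\<Sum>T\<in>Pow (U - S). theta_sign T (U - S - T) * g T * h (U - S - T)))" .
  qed
  show "1 * f = f"
  proof (transfer, rule ext)
    fix f :: "'a set \<Rightarrow> 'a cpoly" and U :: "'a set"
    have "(\<Sum>S\<in>Pow U. theta_sign S (U - S) * (if S = {} then 1 else 0) * f (U - S))
        = (\<Sum>S\<in>Pow U. if S = {} then f U else 0)"
      by (intro sum.cong) auto
    then show "(\<Sum>S\<in>Pow U. theta_sign S (U - S) * (if S = {} then 1 else 0) * f (U - S)) = f U"
      by simp
  qed
  show "f * 1 = f"
  proof (transfer, rule ext)
    fix f :: "'a set \<Rightarrow> 'a cpoly" and U :: "'a set"
    have "(\<Sum>S\<in>Pow U. theta_sign S (U - S) * f S * (if U - S = {} then 1 else 0))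
        = (\<Sum>S\<in>Pow U. if S = U then f U else 0)"
      by (intro sum.cong) auto
    then show "(\<Sum>S\<in>Pow U. theta_sign S (U - S) * f S * (if U - S = {} then 1 else 0)) = f U"
      by simp
  qed
  show "(f + g) * h = f * h + g * h" "f * (g + h) = f * g + f * h"
    by (transfer, simp add: fun_eq_iff algebra_simps sum.distrib)+
  show "(0 :: 'a superspace) \<noteq> 1"
    by transfer (metis zero_neq_one)
qed

end

definition of_poly :: "'n cpoly \<Rightarrow> 'n superspace" where
  "of_poly p = Superspace (\<lambda>S. if S = {} then p else 0)"

definition scalar :: "complex \<Rightarrow> 'n superspace" where
  "scalar c = of_poly (Poly_Mapping.single 0 c)"

definition bosonic :: "'n \<Rightarrow> 'n superspace" where
  "bosonic i = of_poly (Poly_Mapping.single (Poly_Mapping.single i 1) 1)"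

definition fermionic :: "'n \<Rightarrow> 'n superspace" where
  "fermionic i = Superspace (\<lambda>S. if S = {i} then 1 else 0)"

definition poly_deriv :: "'n \<Rightarrow> 'n cpoly \<Rightarrow> 'n cpoly" where
  "poly_deriv i p = (\<Sum>a\<in>Poly_Mapping.keys p.
     Poly_Mapping.single (a - Poly_Mapping.single i 1)
       (of_nat (Poly_Mapping.lookup a i) * Poly_Mapping.lookup p a))"

definition super_deriv :: "'n \<Rightarrow> 'n superspace \<Rightarrow> 'n superspace" where
  "super_deriv i f = Superspace (\<lambda>S. poly_deriv i (theta_coeff f S))"

definition euler_op :: "'n::{finite,linorder} superspace \<Rightarrow> 'n superspace" where
  "euler_op f = (\<Sum>i\<in>UNIV. super_deriv i f * fermionic i)"

definition bidegree_part :: "nat \<Rightarrow> nat \<Rightarrow> 'n::finite superspace set" where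
  "bidegree_part i j = {f. \<forall>S. \<forall>a \<in> Poly_Mapping.keys (theta_coeff f S).
     (\<Sum>k\<in>UNIV. Poly_Mapping.lookup a k) = i \<and> card S = j}"

definition superspace_ring :: "'n::{finite,linorder} superspace ring" where
  "superspace_ring = \<lparr>carrier = UNIV, mult = (*), one = 1, zero = 0, add = (+)\<rparr>"

lemma ring_superspace_ring: "ring (superspace_ring :: 'n::{finite,linorder} superspace ring)"
proof (rule ringI)
  show "abelian_group (superspace_ring :: 'n superspace ring)"
  proof (rule abelian_groupI)
    fix x :: "'n superspace"
    show "\<exists>y\<in>carrier superspace_ring. y \<oplus>\<^bsub>superspace_ring\<^esub> x = \<zero>\<^bsub>superspace_ring\<^esub>"
      by (auto simp: superspace_ring_def intro: exI [of _ "- x"])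
  qed (auto simp: superspace_ring_def algebra_simps)
  show "monoid (superspace_ring :: 'n superspace ring)"
    by (rule monoidI) (auto simp: superspace_ring_def algebra_simps)
qed (auto simp: superspace_ring_def algebra_simps)


section \<open>Multiarrangements\<close>

text \<open>
  A multiarrangement is a list of hyperplanes; subcollections are sets of list positions, so that
  repeated hyperplanes count as distinct. The order of the list is irrelevant.
\<close>

definition hyperplane :: "(complex^'n) set \<Rightarrow> bool" where
  "hyperplane H \<longleftrightarrow> vec.subspace H \<and> vec.dim H + 1 = CARD('n)"

definition multiarrangement :: "(complex^'n) set list \<Rightarrow> bool" where
  "multiarrangement \<A> \<longleftrightarrow> (\<forall>H \<in> set \<A>. hyperplane H)"

text \<open>
  The coefficient vector of a nonzero linear form with zero set \<open>H\<close>, unique up to a nonzero scalar.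
  The pairing is bilinear, not Hermitian.
\<close>

definition normal_form :: "(complex^'n) set \<Rightarrow> complex^'n" where
  "normal_form H = (SOME \<alpha>. \<alpha> \<noteq> 0 \<and> H = {v. (\<Sum>i\<in>UNIV. \<alpha> $ i * v $ i) = 0})"

definition subrank :: "(complex^'n) set list \<Rightarrow> nat set \<Rightarrow> nat" where
  "subrank \<A> S = vec.dim (vec.span ((\<lambda>k. normal_form (\<A> ! k)) ` S))"

definition arr_rank :: "(complex^'n) set list \<Rightarrow> nat" where
  "arr_rank \<A> = subrank \<A> {..<length \<A>}"

text \<open>
  The Tutte polynomial, evaluated in a commutative ring. The truncated subtractions are harmless, as
  \<open>subrank \<A> S \<le> arr_rank \<A>\<close> and \<open>subrank \<A> S \<le> card S\<close>.
\<close>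

definition tutte :: "(complex^'n) set list \<Rightarrow> 'a::comm_ring_1 \<Rightarrow> 'a \<Rightarrow> 'a" where
  "tutte \<A> x y = (\<Sum>S\<in>Pow {..<length \<A>}.
     (x - 1) ^ (arr_rank \<A> - subrank \<A> S) * (y - 1) ^ (card S - subrank \<A> S))"


section \<open>The superspace ideal and its quotient\<close>

definition line_form :: "complex^'n::{finite,linorder} \<Rightarrow> 'n superspace" where
  "line_form v = (\<Sum>i\<in>UNIV. scalar (v $ i) * bosonic i)"

definition line_count :: "(complex^'n) set list \<Rightarrow> (complex^'n) set \<Rightarrow> nat" where
  "line_count \<A> L = card {k. k < length \<A> \<and> \<not> L \<subseteq> \<A> ! k}"

text \<open>
  Every line is spanned by some \<open>v \<noteq> 0\<close>. Taking generators for all such \<open>v\<close>, not just one per line,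
  only adds scalar multiples.
\<close>

definition ideal_gens :: "(complex^'n::{finite,linorder}) set list \<Rightarrow> 'n superspace set" where
  "ideal_gens \<A> = (\<Union>v \<in> - {0}.
     let g = line_form v ^ (line_count \<A> (vec.span {v}) + 1) in {g, euler_op g})"

definition super_ideal :: "(complex^'n::{finite,linorder}) set list \<Rightarrow> 'n superspace set" where
  "super_ideal \<A> = Idl\<^bsub>superspace_ring\<^esub> (ideal_gens \<A>)"

lemma ideal_super_ideal: "ideal (super_ideal \<A>) superspace_ring"
  unfolding super_ideal_def
  by (rule ring.genideal_ideal [OF ring_superspace_ring]) (simp add: superspace_ring_def)

definition super_quot :: "(complex^'n::{finite,linorder}) set list \<Rightarrow> 'n superspace set ring" where
  "super_quot \<A> = superspace_ring Quot super_ideal \<A>"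

abbreviation quot_proj ::
    "(complex^'n::{finite,linorder}) set list \<Rightarrow> 'n superspace \<Rightarrow> 'n superspace set" where
  "quot_proj \<A> f \<equiv> super_ideal \<A> +>\<^bsub>superspace_ring\<^esub> f"

text \<open>
  The complex dimension of a bigraded piece of the quotient, the scalars being the image of the
  constants.
\<close>

definition quot_dim :: "(complex^'n::{finite,linorder}) set list \<Rightarrow> nat \<Rightarrow> nat \<Rightarrow> nat" where
  "quot_dim \<A> i j =
     ring.dim (super_quot \<A>) (quot_proj \<A> ` range scalar) (quot_proj \<A> ` bidegree_part i j)"

text \<open>
  Bigraded Hilbert series are power series in \<open>q\<close> with coefficients power series in \<open>t\<close>, viewed inside
  the field of iterated Laurent series, where both \<open>1 / q\<close> and \<open>1 / (1 + t)\<close> exist.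
\<close>

type_synonym laurent_qt = "rat fls fls"

definition var_q :: laurent_qt where "var_q = fls_X"

definition var_t :: laurent_qt where "var_t = fls_const fls_X"

definition hilb :: "(nat \<Rightarrow> nat \<Rightarrow> nat) \<Rightarrow> laurent_qt" where
  "hilb dims = fps_to_fls (Abs_fps (\<lambda>i. fps_to_fls (Abs_fps (\<lambda>j. of_nat (dims i j)))))"

end

theory Submission
  imports Defs
begin

text \<open>
  Write \<open>\<alpha>\<^sub>0, \<dots>, \<alpha>\<^bsub>m-1\<^esub>\<close> for the normal forms. Each of them acts on superspace by the bosonic
  derivative \<open>\<partial>\<^sub>\<alpha>\<close>, with \<open>x\<^sub>i \<mapsto> \<alpha>(e\<^sub>i)\<close>, and by the contraction \<open>\<iota>\<^sub>\<alpha>\<close>, with \<open>\<theta>\<^sub>i \<mapsto> \<alpha>(e\<^sub>i)\<close>. The ideal turns out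
  to be the common kernel of all functionals obtained by composing such operators for distinct indices and
  evaluating at the origin. Instead of restricting the arrangement to a hyperplane, one keeps the forms and
  shrinks the ambient space to a subspace \<open>U\<close>, looking at the subring generated by \<open>\<lambda>\<^sub>u, \<theta>\<^sub>u\<close> for \<open>u \<in> U\<close>.
  If the last form \<open>\<alpha>\<close> does not vanish on \<open>U\<close>, has kernel \<open>H\<close> there, and \<open>\<alpha>(u) = 1\<close>, then \<open>\<partial>\<^sub>\<alpha>\<close> maps the
  quotient for \<open>U\<close> onto the quotient for \<open>U\<close> with \<open>\<alpha>\<close> deleted, and its kernel is the quotient for \<open>H\<close>
  together with \<open>\<theta>\<^sub>u\<close> times it. This is the deletion-contraction recursion
  \<open>P(U) = q P'(U) + (1 + t) P'(H)\<close>, where \<open>P'\<close> omits \<open>\<alpha>\<close>, satisfied by the right-hand side.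
\<close>

section \<open>Derivatives and contractions on superspace\<close>

lemma theta_coeff_Superspace [simp]: "theta_coeff (Superspace f) = f"
  by (simp add: Superspace_inverse)

lemma superspace_eqI: "(\<And>S. theta_coeff f S = theta_coeff g S) \<Longrightarrow> f = g"
  by (metis ext theta_coeff_inject)

lemmas theta_coeff_simps [simp] =
  zero_superspace.rep_eq plus_superspace.rep_eq minus_superspace.rep_eq uminus_superspace.rep_eq

lemma theta_coeff_sum: "theta_coeff (sum f A) S = (\<Sum>i\<in>A. theta_coeff (f i) S)"
  by (induction A rule: infinite_finite_induct) auto

lemma of_poly_add: "of_poly (p + q) = of_poly p + of_poly q"
  by (rule superspace_eqI) (simp add: of_poly_def)

lemma of_poly_0 [simp]: "of_poly 0 = 0"
  by (rule superspace_eqI) (simp add: of_poly_def)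

lemma theta_coeff_of_poly_mult [simp]:
  fixes f :: "'n::{finite,linorder} superspace"
  shows "theta_coeff (of_poly p * f) U = p * theta_coeff f U"
proof -
  have "theta_coeff (of_poly p * f) U = (\<Sum>S\<in>Pow U. if S = {} then p * theta_coeff f U else 0)"
    unfolding times_superspace.rep_eq by (intro sum.cong) (auto simp: of_poly_def)
  then show ?thesis by simp
qed

lemma theta_coeff_mult_of_poly [simp]:
  fixes f :: "'n::{finite,linorder} superspace"
  shows "theta_coeff (f * of_poly p) U = p * theta_coeff f U"
proof -
  have "theta_coeff (f * of_poly p) U = (\<Sum>S\<in>Pow U. if S = U then p * theta_coeff f U else 0)"
    unfolding times_superspace.rep_eq by (intro sum.cong) (auto simp: of_poly_def algebra_simps)
  then show ?thesis by simp
qed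

lemma of_poly_commute: "f * of_poly p = of_poly p * (f :: 'n::{finite,linorder} superspace)"
  by (rule superspace_eqI) simp

lemma of_poly_mult: "of_poly (p * q) = (of_poly p * of_poly q :: 'n::{finite,linorder} superspace)"
  by (rule superspace_eqI) (simp, simp add: of_poly_def)

lemma scalar_add: "scalar (c + d) = scalar c + scalar d"
  by (simp add: scalar_def single_add of_poly_add)

lemma scalar_0 [simp]: "scalar 0 = 0"
  by (simp add: scalar_def)

lemma scalar_minus: "scalar (- c) = - scalar c"
  by (rule superspace_eqI) (simp add: scalar_def of_poly_def single_uminus)

lemma scalar_1 [simp]: "scalar 1 = (1 :: 'n::{finite,linorder} superspace)"
  by (rule superspace_eqI) (simp add: scalar_def of_poly_def one_superspace.rep_eq)

lemma scalar_mult: "scalar (c * d) = (scalar c * scalar d :: 'n::{finite,linorder} superspace)"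
  by (simp add: scalar_def flip: of_poly_mult) (simp add: mult_single)

lemma scalar_commute: "f * scalar c = scalar c * (f :: 'n::{finite,linorder} superspace)"
  unfolding scalar_def by (rule of_poly_commute)

lemma scalar_left_commute:
  "f * (scalar c * g) = scalar c * (f * g :: 'n::{finite,linorder} superspace)"
  by (metis scalar_commute mult.assoc)

text \<open>Pulling a scalar past an arbitrary left factor could loop on nested scalars. The rule is
  therefore restricted to these factors, and the instance for two scalars is permutative, so that it
  rewrites in an ordered way.\<close>

lemmas scalar_out = scalar_left_commute [of "fermionic i" for i] scalar_left_commute [of "bosonic i" for i]
  scalar_left_commute [of "scalar c" for c]

lemma scalar_sum: "scalar (sum c A) = (\<Sum>i\<in>A. scalar (c i))"
  by (induction A rule: infinite_finite_induct) (auto simp: scalar_add)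

section \<open>Coefficients and product rules of the bosonic partial derivatives\<close>

lemma lookup_poly_deriv:
  "Poly_Mapping.lookup (poly_deriv i p) b =
    of_nat (Suc (Poly_Mapping.lookup b i)) * Poly_Mapping.lookup p (b + Poly_Mapping.single i 1)"
proof -
  let ?e = "Poly_Mapping.single i (1 :: nat)"
  \<comment> \<open>Subtraction of exponents is truncated, so it can be inverted only where
    \<open>i\<close> occurs in \<open>a\<close>. The other exponents enter the sum with coefficient
    \<open>0\<close>.\<close>
  have inv: "a - ?e = b \<longleftrightarrow> a = b + ?e" if "Poly_Mapping.lookup a i \<noteq> 0" for a
  proof
    assume "a - ?e = b"
    then have "b + ?e = a - ?e + ?e" by simp
    also have "\<dots> = a"
      using that by (intro poly_mapping_eqI) (auto simp: lookup_add lookup_minus lookup_single when_def)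
    finally show "a = b + ?e" by simp
  qed simp
  have "Poly_Mapping.lookup (poly_deriv i p) b = (\<Sum>a\<in>Poly_Mapping.keys p.
      (of_nat (Poly_Mapping.lookup a i) * Poly_Mapping.lookup p a when a - ?e = b))"
    by (simp add: poly_deriv_def lookup_sum lookup_single)
  also have "\<dots> = (\<Sum>a\<in>Poly_Mapping.keys p. if a = b + ?e
      then of_nat (Poly_Mapping.lookup a i) * Poly_Mapping.lookup p a else 0)"
  proof (intro sum.cong refl)
    fix a
    show "(of_nat (Poly_Mapping.lookup a i) * Poly_Mapping.lookup p a when a - ?e = b)
      = (if a = b + ?e then of_nat (Poly_Mapping.lookup a i) * Poly_Mapping.lookup p a else 0)"
      using inv[of a] by (cases "Poly_Mapping.lookup a i = 0") (auto simp: when_def)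
  qed
  also have "\<dots> = of_nat (Suc (Poly_Mapping.lookup b i)) * Poly_Mapping.lookup p (b + ?e)"
    by (auto simp: lookup_add in_keys_iff)
  finally show ?thesis .
qed

lemma poly_deriv_add: "poly_deriv i (p + q) = poly_deriv i p + poly_deriv i q"
  by (rule poly_mapping_eqI) (simp add: lookup_poly_deriv lookup_add algebra_simps)

lemma poly_deriv_0 [simp]: "poly_deriv i 0 = 0"
  by (simp add: poly_deriv_def)

lemma poly_deriv_single:
  "poly_deriv i (Poly_Mapping.single a c) =
    Poly_Mapping.single (a - Poly_Mapping.single i 1) (of_nat (Poly_Mapping.lookup a i) * c)"
  by (cases "c = 0") (auto simp: poly_deriv_def)

text \<open>Updating at a key outside the support is the same as adding a monomial, so additive
  statements need to be checked on monomials only.\<close>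

lemma poly_mapping_add_induct [case_names zero add single]:
  fixes p :: "'a \<Rightarrow>\<^sub>0 'b::comm_monoid_add"
  assumes "P 0" "\<And>p q. P p \<Longrightarrow> P q \<Longrightarrow> P (p + q)" "\<And>a c. P (Poly_Mapping.single a c)"
  shows "P p"
proof (induction p rule: Poly_Mapping.update_induct)
  case (update p a c)
  have "Poly_Mapping.update a c p = p + Poly_Mapping.single a c"
    using update by (intro poly_mapping_eqI) (auto simp: lookup_update lookup_add lookup_single in_keys_iff)
  with update assms show ?case by simp
qed (use assms in simp)

text \<open>The Leibniz rule is needed only for a variable as first factor, since everything later
  is built by multiplying with linear forms. On a monomial without \<open>j\<close> the truncated
  exponent is harmless because its coefficient is \<open>0\<close>.\<close>

lemma poly_deriv_var_mult:
  "poly_deriv i (Poly_Mapping.single (Poly_Mapping.single j 1) 1 * p) =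
    (if i = j then p else 0) + Poly_Mapping.single (Poly_Mapping.single j 1) 1 * poly_deriv i p"
proof (induction p rule: poly_mapping_add_induct)
  case (single a c)
  let ?e = "\<lambda>i. Poly_Mapping.single i (1 :: nat)"
  show ?case
  proof (cases "i = j")
    case True
    have "?e j + (a - ?e j) = a" if "Poly_Mapping.lookup a j \<noteq> 0"
      using that by (intro poly_mapping_eqI) (auto simp: lookup_add lookup_minus lookup_single when_def)
    then show ?thesis
      using True by (cases "Poly_Mapping.lookup a j = 0")
        (auto simp: mult_single poly_deriv_single lookup_add algebra_simps simp flip: single_add)
  next
    case False
    then have "?e j + a - ?e i = ?e j + (a - ?e i)"
      by (intro poly_mapping_eqI) (auto simp: lookup_add lookup_minus lookup_single when_def)
    then show ?thesis
      using False by (simp add: mult_single poly_deriv_single lookup_add lookup_single)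
  qed
qed (auto simp: poly_deriv_add algebra_simps)

lemma poly_deriv_const_mult:
  "poly_deriv i (Poly_Mapping.single 0 c * p) = Poly_Mapping.single 0 c * poly_deriv i p"
  by (induction p rule: poly_mapping_add_induct)
    (auto simp: poly_deriv_add mult_single poly_deriv_single algebra_simps)

lemma theta_coeff_super_deriv [simp]:
  "theta_coeff (super_deriv i f) S = poly_deriv i (theta_coeff f S)"
  by (simp add: super_deriv_def)

lemma super_deriv_add: "super_deriv i (f + g) = super_deriv i f + super_deriv i g"
  by (rule superspace_eqI) (simp add: poly_deriv_add)

lemma super_deriv_scalar_mult:
  "super_deriv i (scalar c * f) = scalar c * super_deriv i (f :: 'n::{finite,linorder} superspace)"
  by (rule superspace_eqI) (simp add: scalar_def poly_deriv_const_mult)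

lemma super_deriv_bosonic_mult:
  "super_deriv i (bosonic j * f) =
    (if i = j then f else 0) + bosonic j * super_deriv i (f :: 'n::{finite,linorder} superspace)"
  by (rule superspace_eqI) (simp only: bosonic_def theta_coeff_super_deriv theta_coeff_of_poly_mult
      theta_coeff_simps poly_deriv_var_mult, simp)

section \<open>Signs, contractions and anticommutation of the fermionic variables\<close>

lemma theta_sign_square: "theta_sign S T * theta_sign S T = 1"
  by (simp add: theta_sign_def flip: power_mult_distrib)

lemma theta_sign_swap:
  assumes "i \<noteq> j"
  shows "theta_sign {i} {j} * theta_sign {j} {i} = - 1"
proof -
  have "{(s, t). s \<in> {i} \<and> t \<in> {j} \<and> t < s} = (if j < i then {(i, j)} else {})" for i j :: 'a
    by auto
  then show ?thesis using assms by (auto simp: theta_sign_def neq_iff)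
qed

lemma theta_coeff_fermionic_mult:
  fixes f :: "'n::{finite,linorder} superspace"
  shows "theta_coeff (fermionic j * f) U =
    (if j \<in> U then theta_sign {j} (U - {j}) * theta_coeff f (U - {j}) else 0)"
proof -
  have "theta_coeff (fermionic j * f) U = (\<Sum>S\<in>Pow U. if S = {j}
      then theta_sign {j} (U - {j}) * theta_coeff f (U - {j}) else 0)"
    unfolding times_superspace.rep_eq by (intro sum.cong) (auto simp: fermionic_def)
  then show ?thesis by simp
qed

text \<open>The odd derivation dual to the variable \<open>fermionic i\<close>. Multiplying by that
  variable on the left introduces the factor \<open>theta_sign {i} S\<close>; the sign is its own
  inverse, so removing the variable introduces the same factor.\<close>

definition super_contract :: "'n::{finite,linorder} \<Rightarrow> 'n superspace \<Rightarrow> 'n superspace" where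
  "super_contract i f =
     Superspace (\<lambda>S. if i \<in> S then 0 else theta_sign {i} S * theta_coeff f (insert i S))"

lemma theta_coeff_super_contract:
  "theta_coeff (super_contract i f) S =
    (if i \<in> S then 0 else theta_sign {i} S * theta_coeff f (insert i S))"
  by (simp add: super_contract_def)

lemma super_contract_add: "super_contract i (f + g) = super_contract i f + super_contract i g"
  by (rule superspace_eqI) (simp add: theta_coeff_super_contract algebra_simps)

lemma super_contract_of_poly_mult:
  "super_contract i (of_poly p * f) = of_poly p * super_contract i f"
  by (rule superspace_eqI) (simp add: theta_coeff_super_contract algebra_simps)

text \<open>The Leibniz rule of an odd derivation. For distinct indices the minus sign is the
  product of the two transposition signs from \<open>theta_sign_swap\<close>.\<close>

lemma super_contract_fermionic_mult:
  "super_contract i (fermionic j * f) = (if i = j then f else 0) - fermionic j * super_contract i f"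
proof (rule superspace_eqI)
  fix S
  show "theta_coeff (super_contract i (fermionic j * f)) S =
    theta_coeff ((if i = j then f else 0) - fermionic j * super_contract i f) S"
  proof (cases "i = j")
    case True
    have "theta_sign {i} (S - {i}) * (theta_sign {i} (S - {i}) * x) = x" for x
      by (simp add: theta_sign_square flip: mult.assoc)
    moreover have "insert i (S - {i}) = S" if "i \<in> S" using that by auto
    ultimately show ?thesis
      using True by (auto simp: theta_coeff_super_contract theta_coeff_fermionic_mult insert_absorb)
  next
    case False
    show ?thesis
    \<comment> \<open>For distinct \<open>i\<close> and \<open>j\<close> this is the only case in
      which either side can be nonzero.\<close>
    proof (cases "i \<notin> S \<and> j \<in> S")
      case True
      have d: "insert i S - {j} = insert i (S - {j})" using False by auto
      have "theta_sign {i} S = theta_sign {i} (S - {j}) * theta_sign {i} {j}"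
        using theta_sign_Un_right[of "S - {j}" "{j}" "{i}"] True by (simp add: insert_absorb)
      moreover have "theta_sign {j} (insert i (S - {j})) =
          theta_sign {j} (S - {j}) * theta_sign {j} {i}"
        using theta_sign_Un_right[of "S - {j}" "{i}" "{j}"] True by simp
      ultimately have "theta_sign {i} S * theta_sign {j} (insert i (S - {j})) =
          (theta_sign {i} {j} * theta_sign {j} {i}) *
            (theta_sign {i} (S - {j}) * theta_sign {j} (S - {j}))"
        by (simp only: ac_simps)
      then have "theta_sign {i} S * theta_sign {j} (insert i (S - {j})) =
          - (theta_sign {j} (S - {j}) * theta_sign {i} (S - {j}))"
        using False by (simp add: theta_sign_swap mult.commute)
      then show ?thesis
        using True False by (simp add: theta_coeff_super_contract theta_coeff_fermionic_mult d
            flip: mult.assoc)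
    qed (use False in \<open>auto simp: theta_coeff_super_contract theta_coeff_fermionic_mult\<close>)
  qed
qed

text \<open>Both orders reach the same coefficient of \<open>f\<close>, and their signs differ only
  in \<open>theta_sign {i} {j}\<close> against \<open>theta_sign {j} {i}\<close>, which are
  opposite.\<close>

lemma fermionic_anticommute:
  "fermionic i * (fermionic j * f) = - (fermionic j * (fermionic i * f))" (is "?l i j = - ?l j i")
proof (rule superspace_eqI)
  fix S
  show "theta_coeff (?l i j) S = theta_coeff (- ?l j i) S"
  proof (cases "i \<noteq> j \<and> i \<in> S \<and> j \<in> S")
    case True
    let ?T = "S - {i} - {j}"
    have d: "S - {j} - {i} = ?T" by auto
    have e: "S - {i} = ?T \<union> {j}" "S - {j} = ?T \<union> {i}" using True by auto
    have "theta_sign {i} (S - {i}) = theta_sign {i} ?T * theta_sign {i} {j}"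
      "theta_sign {j} (S - {j}) = theta_sign {j} ?T * theta_sign {j} {i}"
      by (subst e, rule theta_sign_Un_right, blast)+
    moreover have "theta_sign {i} {j} = - theta_sign {j} {i}"
    proof -
      have "theta_sign {i} {j} = theta_sign {i} {j} * (theta_sign {j} {i} * theta_sign {j} {i})"
        by (simp add: theta_sign_square)
      also have "\<dots> = - theta_sign {j} {i}"
        using True by (simp add: theta_sign_swap flip: mult.assoc)
      finally show ?thesis .
    qed
    ultimately have *: "theta_sign {i} (S - {i}) * (theta_sign {j} ?T * x) =
        - (theta_sign {j} (S - {j}) * (theta_sign {i} ?T * x))" for x
      by (simp only: ac_simps mult_minus_left mult_minus_right)
    have "theta_coeff (?l i j) S = theta_sign {i} (S - {i}) * (theta_sign {j} ?T * theta_coeff f ?T)"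
      "theta_coeff (?l j i) S = theta_sign {j} (S - {j}) * (theta_sign {i} ?T * theta_coeff f ?T)"
      using True by (auto simp: theta_coeff_fermionic_mult d)
    then show ?thesis by (simp only: * theta_coeff_simps)
  qed (auto simp: theta_coeff_fermionic_mult)
qed

section \<open>Vectors as linear forms, with their derivative and contraction operators\<close>

definition dot :: "complex^'n \<Rightarrow> complex^'n \<Rightarrow> complex" where
  "dot a v = (\<Sum>i\<in>UNIV. a $ i * v $ i)"

lemma dot_add_right: "dot a (v + w) = dot a v + dot a w"
  by (simp add: dot_def sum.distrib algebra_simps)

lemma dot_scale_right: "dot a (c *s v) = c * dot a v"
  by (simp add: dot_def sum_distrib_left algebra_simps)

lemma dot_zero_right [simp]: "dot a 0 = 0"
  by (simp add: dot_def)

lemma dot_diff_right: "dot a (v - w) = dot a v - dot a w"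
  by (simp add: dot_def sum_subtractf algebra_simps)

lemma dot_commute: "dot a v = dot v a"
  by (simp add: dot_def mult.commute)

lemma dot_axis_left [simp]: "dot (axis i 1) v = v $ i"
  by (simp add: dot_def axis_def if_distrib if_distribR sum.If_cases cong: if_cong)

text \<open>The image of \<open>line_form v\<close> under \<open>euler_op\<close>. Up to a nonzero
  scalar, the fermionic generators are therefore products of powers of \<open>line_form v\<close>
  with \<open>theta_form v\<close>.\<close>

definition theta_form :: "complex^'n::{finite,linorder} \<Rightarrow> 'n superspace" where
  "theta_form v = (\<Sum>i\<in>UNIV. scalar (v $ i) * fermionic i)"

lemma line_form_mult: "line_form v * f = (\<Sum>i\<in>UNIV. scalar (v $ i) * (bosonic i * f))"
  by (simp add: line_form_def sum_distrib_right mult.assoc)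

lemma theta_form_mult: "theta_form v * f = (\<Sum>i\<in>UNIV. scalar (v $ i) * (fermionic i * f))"
  by (simp add: theta_form_def sum_distrib_right mult.assoc)

lemma line_form_add: "line_form (v + w) = line_form v + line_form w"
  by (simp add: line_form_def scalar_add algebra_simps sum.distrib)

lemma theta_form_add: "theta_form (v + w) = theta_form v + theta_form w"
  by (simp add: theta_form_def scalar_add algebra_simps sum.distrib)

lemma line_form_scale: "line_form (c *s v) = scalar c * line_form v"
  by (simp add: line_form_def scalar_mult sum_distrib_left mult.assoc)

lemma theta_form_scale: "theta_form (c *s v) = scalar c * theta_form v"
  by (simp add: theta_form_def scalar_mult sum_distrib_left mult.assoc)

lemma line_form_axis: "line_form (axis i 1) = bosonic i"
proof -
  have "line_form (axis i 1) = (\<Sum>j\<in>UNIV. if j = i then bosonic j else 0)"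
    unfolding line_form_def by (intro sum.cong) (auto simp: axis_def)
  then show ?thesis by simp
qed

lemma theta_form_axis: "theta_form (axis i 1) = fermionic i"
proof -
  have "theta_form (axis i 1) = (\<Sum>j\<in>UNIV. if j = i then fermionic j else 0)"
    unfolding theta_form_def by (intro sum.cong) (auto simp: axis_def)
  then show ?thesis by simp
qed

lemma line_form_commute: "f * line_form v = line_form v * f"
proof -
  have "f * (scalar c * bosonic i) = scalar c * (bosonic i * f)" for c i
    using of_poly_commute [of f] by (simp add: bosonic_def scalar_left_commute)
  then show ?thesis
    by (simp add: line_form_def sum_distrib_left sum_distrib_right mult.assoc)
qed

lemma line_form_left_commute: "f * (line_form v * g) = line_form v * (f * g)"
  by (metis line_form_commute mult.assoc)

lemma line_form_power_commute: "f * line_form v ^ k = line_form v ^ k * f"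
  by (induction k) (auto simp: mult.assoc line_form_left_commute)

lemma line_form_power_left_commute: "f * (line_form v ^ k * g) = line_form v ^ k * (f * g)"
  by (metis line_form_power_commute mult.assoc)

lemma theta_form_anticommute: "theta_form v * (theta_form w * f) = - (theta_form w * (theta_form v * f))"
proof -
  have swap: "scalar c * (scalar d * (fermionic i * (fermionic j * f))) =
      - (scalar d * (scalar c * (fermionic j * (fermionic i * f))))" for c d i j
    by (subst fermionic_anticommute) (simp add: scalar_left_commute [of "scalar c"])
  have "theta_form v * (theta_form w * f) =
      (\<Sum>i\<in>UNIV. \<Sum>j\<in>UNIV. scalar (v $ i) * (scalar (w $ j) * (fermionic i * (fermionic j * f))))"
    by (simp add: theta_form_mult sum_distrib_left scalar_out) (rule sum.swap)
  also have "\<dots> = - (\<Sum>i\<in>UNIV. \<Sum>j\<in>UNIV.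
      scalar (w $ j) * (scalar (v $ i) * (fermionic j * (fermionic i * f))))"
    by (subst swap) (simp add: sum_negf)
  also have "\<dots> = - (theta_form w * (theta_form v * f))"
    by (simp add: theta_form_mult sum_distrib_left scalar_out)
  finally show ?thesis .
qed

lemma scalar_mult_eq_0_iff [simp]: "scalar c * f = 0 \<longleftrightarrow> c = 0 \<or> f = (0 :: 'n::{finite,linorder} superspace)"
proof
  assume *: "scalar c * f = 0"
  have "f = scalar (inverse c) * (scalar c * f)" if "c \<noteq> 0"
    using that by (simp flip: mult.assoc scalar_mult)
  with * show "c = 0 \<or> f = 0" by auto
qed auto

text \<open>Anticommutation with itself makes the product equal to its own negative, and the scalar
  \<open>2\<close> is invertible.\<close>

lemma theta_form_square [simp]: "theta_form v * (theta_form v * f) = 0"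
proof -
  have "scalar 2 * (theta_form v * (theta_form v * f)) =
      theta_form v * (theta_form v * f) + theta_form v * (theta_form v * f)"
    by (metis distrib_right mult_1 one_add_one scalar_1 scalar_add)
  also have "\<dots> = 0"
    by (subst theta_form_anticommute) simp
  finally show ?thesis by simp
qed

definition dir_deriv :: "complex^'n::{finite,linorder} \<Rightarrow> 'n superspace \<Rightarrow> 'n superspace" where
  "dir_deriv a f = (\<Sum>i\<in>UNIV. scalar (a $ i) * super_deriv i f)"

definition contraction :: "complex^'n::{finite,linorder} \<Rightarrow> 'n superspace \<Rightarrow> 'n superspace" where
  "contraction a f = (\<Sum>i\<in>UNIV. scalar (a $ i) * super_contract i f)"

lemma dir_deriv_add: "dir_deriv a (f + g) = dir_deriv a f + dir_deriv a g"
  by (simp add: dir_deriv_def super_deriv_add algebra_simps sum.distrib)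

lemma contraction_add: "contraction a (f + g) = contraction a f + contraction a g"
  by (simp add: contraction_def super_contract_add algebra_simps sum.distrib)

lemma dir_deriv_scalar_mult: "dir_deriv a (scalar c * f) = scalar c * dir_deriv a f"
  by (simp add: dir_deriv_def super_deriv_scalar_mult sum_distrib_left scalar_out)

lemma contraction_scalar_mult: "contraction a (scalar c * f) = scalar c * contraction a f"
proof -
  have "super_contract i (scalar c * f) = scalar c * super_contract i f" for i
    by (simp add: scalar_def super_contract_of_poly_mult)
  then show ?thesis by (simp add: contraction_def sum_distrib_left scalar_out)
qed

lemma scalar_minus_one_mult: "scalar (- 1) * f = - (f :: 'n::{finite,linorder} superspace)"
  by (simp add: scalar_minus)

lemma dir_deriv_0 [simp]: "dir_deriv a 0 = 0"
  using dir_deriv_add[of a 0 0] by simp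

lemma contraction_0 [simp]: "contraction a 0 = 0"
  using contraction_add[of a 0 0] by simp

lemma dir_deriv_minus: "dir_deriv a (- f) = - dir_deriv a f"
  using dir_deriv_scalar_mult[of a "- 1" f] by (simp add: scalar_minus_one_mult)

lemma dir_deriv_diff: "dir_deriv a (f - g) = dir_deriv a f - dir_deriv a g"
  using dir_deriv_add[of a f "- g"] by (simp add: dir_deriv_minus)

lemma dir_deriv_sum: "dir_deriv a (sum f A) = (\<Sum>i\<in>A. dir_deriv a (f i))"
  by (induction A rule: infinite_finite_induct) (auto simp: dir_deriv_add)

lemma contraction_sum: "contraction a (sum f A) = (\<Sum>i\<in>A. contraction a (f i))"
  by (induction A rule: infinite_finite_induct) (auto simp: contraction_add)

lemma dir_deriv_scalar [simp]: "dir_deriv a (scalar c) = 0"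
proof -
  have "super_deriv i (scalar c) = 0" for i :: 'a
    by (rule superspace_eqI) (simp add: scalar_def of_poly_def poly_deriv_single)
  then show ?thesis by (simp add: dir_deriv_def)
qed

lemma contraction_scalar [simp]: "contraction a (scalar c) = 0"
proof -
  have "super_contract i (scalar c) = 0" for i :: 'a
    by (rule superspace_eqI) (simp add: scalar_def of_poly_def theta_coeff_super_contract)
  then show ?thesis by (simp add: contraction_def)
qed

lemma sum_scalar_if_mult:
  fixes v :: "complex^'n::{finite,linorder}"
  shows "(\<Sum>j\<in>UNIV. scalar (v $ j) * (if i = j then f else 0)) = scalar (v $ i) * f"
proof -
  have "(\<Sum>j\<in>UNIV. scalar (v $ j) * (if i = j then f else 0)) =
      (\<Sum>j\<in>UNIV. if i = j then scalar (v $ i) * f else 0)"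
    by (intro sum.cong) auto
  then show ?thesis by simp
qed

lemma dir_deriv_bosonic_mult:
  "dir_deriv a (bosonic j * f) = scalar (a $ j) * f + bosonic j * dir_deriv a f"
proof -
  have "dir_deriv a (bosonic j * f) = (\<Sum>i\<in>UNIV. scalar (a $ i) * (if j = i then f else 0))
      + bosonic j * dir_deriv a f"
    by (simp add: dir_deriv_def super_deriv_bosonic_mult sum.distrib distrib_left sum_distrib_left
        scalar_out eq_commute)
  then show ?thesis by (simp only: sum_scalar_if_mult)
qed

lemma contraction_fermionic_mult:
  "contraction a (fermionic j * f) = scalar (a $ j) * f - fermionic j * contraction a f"
proof -
  have "contraction a (fermionic j * f) = (\<Sum>i\<in>UNIV. scalar (a $ i) * (if j = i then f else 0))
      - fermionic j * contraction a f"
    by (simp add: contraction_def super_contract_fermionic_mult sum_subtractf right_diff_distrib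
        sum_distrib_left scalar_out eq_commute)
  then show ?thesis by (simp only: sum_scalar_if_mult)
qed

lemma contraction_bosonic_mult: "contraction a (bosonic j * f) = bosonic j * contraction a f"
proof -
  have "super_contract i (bosonic j * f) = bosonic j * super_contract i f" for i
    by (simp add: bosonic_def super_contract_of_poly_mult)
  then show ?thesis by (simp add: contraction_def sum_distrib_left scalar_out)
qed

lemma theta_sign_cases: "theta_sign S T = 1 \<or> theta_sign S T = - 1"
  by (auto simp: theta_sign_def minus_one_power_iff)

lemma poly_deriv_theta_sign_mult: "poly_deriv i (theta_sign S T * p) = theta_sign S T * poly_deriv i p"
proof -
  have "theta_sign S T = Poly_Mapping.single 0 1 \<or> theta_sign S T = Poly_Mapping.single 0 (- 1)"
    using theta_sign_cases[of S T] by (auto simp: single_uminus)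
  then show ?thesis by (metis poly_deriv_const_mult)
qed

lemma dir_deriv_fermionic_mult: "dir_deriv a (fermionic j * f) = fermionic j * dir_deriv a f"
proof -
  have "super_deriv i (fermionic j * f) = fermionic j * super_deriv i f" for i
    by (rule superspace_eqI) (simp add: theta_coeff_fermionic_mult poly_deriv_theta_sign_mult)
  then show ?thesis by (simp add: dir_deriv_def sum_distrib_left scalar_out)
qed

lemma scalar_dot_mult: "scalar (dot a v) * f = (\<Sum>i\<in>UNIV. scalar (v $ i) * (scalar (a $ i) * f))"
  by (simp add: dot_def scalar_sum sum_distrib_right mult.commute [of "a $ _"]
      flip: mult.assoc scalar_mult)

lemma dir_deriv_line_form_mult:
  "dir_deriv a (line_form v * f) = scalar (dot a v) * f + line_form v * dir_deriv a f"
  by (simp add: line_form_mult dir_deriv_sum dir_deriv_scalar_mult dir_deriv_bosonic_mult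
      distrib_left sum.distrib scalar_dot_mult)

lemma dir_deriv_theta_form_mult: "dir_deriv a (theta_form v * f) = theta_form v * dir_deriv a f"
  by (simp add: theta_form_mult dir_deriv_sum dir_deriv_scalar_mult dir_deriv_fermionic_mult)

lemma contraction_line_form_mult: "contraction a (line_form v * f) = line_form v * contraction a f"
  by (simp add: line_form_mult contraction_sum contraction_scalar_mult contraction_bosonic_mult)

lemma contraction_theta_form_mult:
  "contraction a (theta_form v * f) = scalar (dot a v) * f - theta_form v * contraction a f"
  by (simp add: theta_form_mult contraction_sum contraction_scalar_mult contraction_fermionic_mult
      right_diff_distrib sum_subtractf scalar_dot_mult)

text \<open>The power rule combined with the product rule, by peeling off one factor at a time.
  Stating it for \<open>Suc k\<close> avoids a truncated exponent \<open>k - 1\<close>.\<close>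

lemma dir_deriv_line_form_power_mult:
  "dir_deriv a (line_form v ^ Suc k * f) =
    scalar (of_nat (Suc k) * dot a v) * (line_form v ^ k * f) + line_form v ^ Suc k * dir_deriv a f"
proof (induction k)
  case (Suc k)
  have "dir_deriv a (line_form v ^ Suc (Suc k) * f) =
      dir_deriv a (line_form v * (line_form v ^ Suc k * f))"
    by (simp add: mult.assoc)
  also have "\<dots> = scalar (dot a v) * (line_form v ^ Suc k * f) +
      line_form v * (scalar (of_nat (Suc k) * dot a v) * (line_form v ^ k * f)
        + line_form v ^ Suc k * dir_deriv a f)"
    by (simp only: dir_deriv_line_form_mult Suc.IH)
  also have "\<dots> = scalar (dot a v + of_nat (Suc k) * dot a v) * (line_form v ^ Suc k * f) +
      line_form v ^ Suc (Suc k) * dir_deriv a f"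
    unfolding scalar_add distrib_left distrib_right scalar_left_commute [of "line_form v"]
    by (simp add: mult.assoc)
  also have "dot a v + of_nat (Suc k) * dot a v = of_nat (Suc (Suc k)) * dot a v"
    by (simp add: algebra_simps)
  finally show ?case .
qed (simp add: dir_deriv_line_form_mult)

lemma contraction_line_form_power_mult:
  "contraction a (line_form v ^ k * f) = line_form v ^ k * contraction a f"
  by (induction k) (auto simp: mult.assoc contraction_line_form_mult)

section \<open>Evaluation at the origin\<close>

definition const_coeff :: "'n superspace \<Rightarrow> complex" where
  "const_coeff f = Poly_Mapping.lookup (theta_coeff f {}) 0"

lemma const_coeff_add: "const_coeff (f + g) = const_coeff f + const_coeff g"
  by (simp add: const_coeff_def lookup_add)

lemma const_coeff_0 [simp]: "const_coeff 0 = 0"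
  by (simp add: const_coeff_def)

lemma const_coeff_scalar [simp]: "const_coeff (scalar c) = c"
  by (simp add: const_coeff_def scalar_def of_poly_def)

lemma const_coeff_sum: "const_coeff (sum f A) = (\<Sum>i\<in>A. const_coeff (f i))"
  by (induction A rule: infinite_finite_induct) (auto simp: const_coeff_add)

text \<open>Exponents are natural numbers, so a product of monomials is constant only if both
  factors are.\<close>

lemma lookup_monomial_mult_0:
  fixes p :: "'n cpoly"
  shows "Poly_Mapping.lookup (Poly_Mapping.single a c * p) 0 =
    (if a = 0 then c * Poly_Mapping.lookup p 0 else 0)"
proof (induction p rule: poly_mapping_add_induct)
  case (single b d)
  have "a + b = 0 \<longleftrightarrow> a = 0 \<and> b = 0"
    by (simp add: poly_mapping_eq_iff fun_eq_iff lookup_add) blast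
  then show ?case by (auto simp: mult_single lookup_single when_def)
qed (auto simp: lookup_add algebra_simps)

lemma const_coeff_scalar_mult: "const_coeff (scalar c * f) = c * const_coeff f"
  by (simp add: const_coeff_def scalar_def lookup_monomial_mult_0)

lemma const_coeff_line_form_mult [simp]: "const_coeff (line_form v * f) = 0"
proof -
  have "Poly_Mapping.single i (1 :: nat) \<noteq> 0" for i :: 'a
    by (metis lookup_single_eq lookup_zero zero_neq_one)
  then have "const_coeff (bosonic i * f) = 0" for i
    by (simp add: const_coeff_def bosonic_def lookup_monomial_mult_0)
  then show ?thesis
    by (simp add: line_form_mult const_coeff_sum const_coeff_scalar_mult)
qed

lemma const_coeff_theta_form_mult [simp]: "const_coeff (theta_form v * f) = 0"
proof -
  have "const_coeff (fermionic i * f) = 0" for i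
    by (simp add: const_coeff_def theta_coeff_fermionic_mult)
  then show ?thesis
    by (simp add: theta_form_mult const_coeff_sum const_coeff_scalar_mult)
qed

section \<open>The power ideal as a common kernel\<close>

text \<open>
  The bihomogeneous elements of the subring generated by \<open>line_form u\<close> and \<open>theta_form u\<close> for \<open>u \<in> U\<close>.
  Degrees are integers, the pieces of negative degree being \<open>0\<close>, so that lowering a degree needs no case
  distinction.
\<close>

inductive super_piece :: "(complex^'n::{finite,linorder}) set \<Rightarrow> int \<Rightarrow> int \<Rightarrow> 'n superspace \<Rightarrow> bool"
  for U where
  scalar: "super_piece U 0 0 (scalar c)"
| zero [simp]: "super_piece U i j 0"
| add: "super_piece U i j f \<Longrightarrow> super_piece U i j g \<Longrightarrow> super_piece U i j (f + g)"
| line: "v \<in> U \<Longrightarrow> super_piece U i j f \<Longrightarrow> super_piece U (i + 1) j (line_form v * f)"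
| theta: "v \<in> U \<Longrightarrow> super_piece U i j f \<Longrightarrow> super_piece U i (j + 1) (theta_form v * f)"

text \<open>Scaling is not a constructor: the scalar is pushed through the linear factors until it
  reaches a constant.\<close>

lemma super_piece_scale: "super_piece U i j f \<Longrightarrow> super_piece U i j (scalar c * f)"
proof (induction rule: super_piece.induct)
  case (scalar d)
  then show ?case by (metis scalar_mult super_piece.scalar)
qed (auto simp: distrib_left super_piece.add scalar_left_commute [of "line_form _", symmetric]
    scalar_left_commute [of "theta_form _", symmetric] intro: super_piece.line super_piece.theta)

lemma super_piece_minus: "super_piece U i j f \<Longrightarrow> super_piece U i j (- f)"
  using super_piece_scale[of U i j f "- 1"] by (simp add: scalar_minus_one_mult)

lemma super_piece_diff:
  "super_piece U i j f \<Longrightarrow> super_piece U i j g \<Longrightarrow> super_piece U i j (f - g)"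
  using super_piece.add super_piece_minus by fastforce

lemma super_piece_mono: "super_piece U i j f \<Longrightarrow> U \<subseteq> W \<Longrightarrow> super_piece W i j f"
  by (induction rule: super_piece.induct) (auto intro: super_piece.intros)

lemma super_piece_negative: "super_piece U i j f \<Longrightarrow> f = 0 \<or> 0 \<le> i \<and> 0 \<le> j"
  by (induction rule: super_piece.induct) auto

lemma super_piece_line': "v \<in> U \<Longrightarrow> super_piece U (i - 1) j f \<Longrightarrow> super_piece U i j (line_form v * f)"
  using super_piece.line[of v U "i - 1" j f] by simp

lemma super_piece_theta': "v \<in> U \<Longrightarrow> super_piece U i (j - 1) f \<Longrightarrow> super_piece U i j (theta_form v * f)"
  using super_piece.theta[of v U i "j - 1" f] by simp

lemma super_piece_line_power:
  "v \<in> U \<Longrightarrow> super_piece U i j f \<Longrightarrow> super_piece U (i + int k) j (line_form v ^ k * f)"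
proof (induction k)
  case (Suc k)
  then have "super_piece U (i + int k + 1) j (line_form v * (line_form v ^ k * f))"
    by (intro super_piece.line) auto
  then show ?case by (simp add: mult.assoc add_ac)
qed simp

lemma super_piece_dir_deriv: "super_piece U i j f \<Longrightarrow> super_piece U (i - 1) j (dir_deriv a f)"
proof (induction rule: super_piece.induct)
  case (line v i j f)
  then show ?case
    by (auto simp: dir_deriv_line_form_mult intro!: super_piece.add super_piece_scale super_piece_line')
qed (auto simp: dir_deriv_add dir_deriv_theta_form_mult intro: super_piece.intros)

text \<open>Both operators satisfy product rules and kill constants, and on linear factors they only
  see \<open>dot a v\<close>, which is \<open>0\<close> throughout \<open>U\<close>.\<close>

lemma super_piece_annihilated:
  assumes "super_piece U i j f" "\<And>v. v \<in> U \<Longrightarrow> dot a v = 0"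
  shows "dir_deriv a f = 0" "contraction a f = 0"
  using assms by (induction rule: super_piece.induct)
    (auto simp: dir_deriv_add contraction_add dir_deriv_line_form_mult dir_deriv_theta_form_mult
      contraction_line_form_mult contraction_theta_form_mult)

text \<open>Integration by parts: the antiderivative is built by recursion on the degree of \<open>f\<close>.\<close>

lemma super_piece_antiderivative:
  assumes "v \<in> U" "dot a v \<noteq> 0" "super_piece U i j f"
  shows "\<exists>F. super_piece U i j F \<and> dir_deriv a (line_form v ^ Suc k * F) = line_form v ^ k * f"
  using assms(3)
proof (induction "nat (i + 1)" arbitrary: i f k rule: less_induct)
  case less
  show ?case
  proof (cases "i < 0")
    case True
    with super_piece_negative[OF less.prems] have "f = 0" by auto
    then show ?thesis by (intro exI[of _ 0]) simp
  next
    case False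
    then obtain F where F: "super_piece U (i - 1) j F"
      "dir_deriv a (line_form v ^ Suc (Suc k) * F) = line_form v ^ Suc k * dir_deriv a f"
      using less.hyps[OF _ super_piece_dir_deriv[OF less.prems], of "Suc k" a] by auto
    let ?c = "of_nat (Suc k) * dot a v"
    \<comment> \<open>\<open>F\<close> integrates the unwanted term
      \<open>line_form v ^ Suc k * dir_deriv a f\<close> of the product rule. Subtracting it leaves
      \<open>?c\<close> times the target.\<close>
    let ?g = "f - line_form v * F"
    have "super_piece U i j ?g"
      using super_piece_line'[OF \<open>v \<in> U\<close> F(1)] less.prems by (rule super_piece_diff[rotated])
    moreover have "dir_deriv a (line_form v ^ Suc k * (scalar (inverse ?c) * ?g)) = line_form v ^ k * f"
    proof -
      have c: "?c \<noteq> 0"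
        using \<open>dot a v \<noteq> 0\<close> by (metis mult_eq_0_iff of_nat_eq_0_iff nat.distinct(1))
      have "line_form v ^ Suc k * ?g = line_form v ^ Suc k * f - line_form v ^ Suc (Suc k) * F"
        by (simp only: power_Suc2 mult.assoc right_diff_distrib)
      then have "dir_deriv a (line_form v ^ Suc k * ?g) = scalar ?c * (line_form v ^ k * f)"
        by (simp only: dir_deriv_diff F(2) dir_deriv_line_form_power_mult[of a v k f]) simp
      then have "dir_deriv a (line_form v ^ Suc k * (scalar (inverse ?c) * ?g)) =
          scalar (inverse ?c) * (scalar ?c * (line_form v ^ k * f))"
        by (simp only: scalar_left_commute[of "line_form v ^ Suc k"] dir_deriv_scalar_mult)
      then show ?thesis
        using left_inverse[OF c] by (metis (no_types, lifting) mult.assoc mult_1 scalar_1 scalar_mult)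
    qed
    ultimately show ?thesis using super_piece_scale by blast
  qed
qed

text \<open>Each \<open>v\<close> in \<open>U\<close> is a vector of the kernel of \<open>a\<close>
  plus \<open>dot a v\<close> times \<open>u\<close>. Everything divisible by
  \<open>line_form u\<close> is collected in \<open>g\<close>; the rest is at most linear in
  \<open>theta_form u\<close>, whose square is \<open>0\<close>.\<close>

lemma super_piece_split:
  assumes "vec.subspace U" "u \<in> U" "dot a u = 1" "super_piece U i j f"
  shows "\<exists>h0 h1 g. super_piece (U \<inter> {v. dot a v = 0}) i j h0 \<and>
    super_piece (U \<inter> {v. dot a v = 0}) i (j - 1) h1 \<and> super_piece U (i - 1) j g \<and>
    f = h0 + theta_form u * h1 + line_form u * g"
  using assms(4)
proof (induction rule: super_piece.induct)
  case (scalar c)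
  show ?case by (intro exI[of _ "scalar c"] exI[of _ 0]) (simp add: super_piece.scalar)
next
  case (zero i j)
  show ?case by (intro exI[of _ 0]) simp
next
  case (add i j f g)
  then obtain h0 h1 e h0' h1' e' where
    "super_piece (U \<inter> {v. dot a v = 0}) i j h0" "super_piece (U \<inter> {v. dot a v = 0}) i j h0'"
    "super_piece (U \<inter> {v. dot a v = 0}) i (j - 1) h1" "super_piece (U \<inter> {v. dot a v = 0}) i (j - 1) h1'"
    "super_piece U (i - 1) j e" "super_piece U (i - 1) j e'"
    "f = h0 + theta_form u * h1 + line_form u * e" "g = h0' + theta_form u * h1' + line_form u * e'"
    by blast
  then show ?case
    by (intro exI[of _ "h0 + h0'"] exI[of _ "h1 + h1'"] exI[of _ "e + e'"])
      (auto simp: distrib_left super_piece.add)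
next
  case (line v i j f)
  let ?H = "U \<inter> {v. dot a v = 0}"
  let ?c = "dot a v"
  let ?w = "v - ?c *s u"
  obtain h0 h1 g where IH: "super_piece ?H i j h0" "super_piece ?H i (j - 1) h1"
    "super_piece U (i - 1) j g" "f = h0 + theta_form u * h1 + line_form u * g"
    using line.IH by blast
  have w: "?w \<in> ?H"
    using assms line.hyps
    by (auto simp: dot_diff_right dot_scale_right vec.subspace_diff vec.subspace_scale)
  have v: "line_form v = line_form ?w + scalar ?c * line_form u"
    using line_form_add[of ?w "?c *s u"] by (simp add: line_form_scale)
  have "line_form v * f = line_form ?w * h0 + theta_form u * (line_form ?w * h1)
      + line_form u * (line_form ?w * g + scalar ?c * f)"
    unfolding v IH(4)
    by (simp add: distrib_left distrib_right mult.assoc line_form_left_commute[of "line_form ?w"]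
        line_form_left_commute[of "theta_form u"] scalar_left_commute[of "line_form u"])
  moreover have "super_piece ?H (i + 1) j (line_form ?w * h0)"
    "super_piece ?H (i + 1) (j - 1) (line_form ?w * h1)"
    using w IH by (auto intro: super_piece.line)
  moreover have "super_piece U i j (line_form ?w * g + scalar ?c * f)"
    using w IH(3) line.hyps
    by (intro super_piece.add super_piece_scale super_piece_line') auto
  ultimately show ?case by fastforce
next
  case (theta v i j f)
  let ?H = "U \<inter> {v. dot a v = 0}"
  let ?c = "dot a v"
  let ?w = "v - ?c *s u"
  obtain h0 h1 g where IH: "super_piece ?H i j h0" "super_piece ?H i (j - 1) h1"
    "super_piece U (i - 1) j g" "f = h0 + theta_form u * h1 + line_form u * g"
    using theta.IH by blast
  have w: "?w \<in> ?H"
    using assms theta.hyps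
    by (auto simp: dot_diff_right dot_scale_right vec.subspace_diff vec.subspace_scale)
  have v: "theta_form v = theta_form ?w + scalar ?c * theta_form u"
    using theta_form_add[of ?w "?c *s u"] by (simp add: theta_form_scale)
  \<comment> \<open>The product of \<open>theta_form u\<close> with \<open>theta_form u * h1\<close>
    disappears, and moving \<open>theta_form ?w\<close> past \<open>theta_form u\<close> produces
    the minus sign.\<close>
  have "theta_form v * f = theta_form ?w * h0 + theta_form u * (scalar ?c * h0 - theta_form ?w * h1)
      + line_form u * (theta_form ?w * g + scalar ?c * (theta_form u * g))"
    unfolding v IH(4)
    by (simp add: distrib_left distrib_right right_diff_distrib mult.assoc
        line_form_left_commute[of "theta_form _"] scalar_left_commute[of "line_form u"]
        scalar_left_commute[of "theta_form u"] theta_form_anticommute[of ?w u])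
  moreover have "super_piece ?H i (j + 1) (theta_form ?w * h0)"
    using w IH by (auto intro: super_piece.theta)
  moreover have "super_piece ?H i (j + 1 - 1) (scalar ?c * h0 - theta_form ?w * h1)"
    using w IH by (intro super_piece_diff super_piece_scale super_piece_theta') auto
  moreover have "super_piece U (i - 1) (j + 1) (theta_form ?w * g + scalar ?c * (theta_form u * g))"
    using w IH assms by (intro super_piece.add super_piece_scale super_piece.theta) auto
  ultimately show ?case by blast
qed

text \<open>The operator \<open>line_form u * dir_deriv a g\<close> measures the degree in
  \<open>line_form u\<close>, so it has no negative eigenvalue. Concretely, differentiating the
  equation gives the same equation for \<open>dir_deriv a g\<close> with \<open>Suc k\<close>. By
  induction on the degree this derivative vanishes, and then so does \<open>g\<close>.\<close>

lemma super_piece_euler_injective: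
  assumes "dot a u = 1" "super_piece U i j g"
    "scalar (of_nat (Suc k)) * g + line_form u * dir_deriv a g = 0"
  shows "g = 0"
  using assms(2,3)
proof (induction "nat (i + 1)" arbitrary: i g k rule: less_induct)
  case less
  show ?case
  proof (cases "i < 0")
    case True
    with super_piece_negative[OF less.prems(1)] show ?thesis by auto
  next
    case False
    have "0 = dir_deriv a (scalar (of_nat (Suc k)) * g + line_form u * dir_deriv a g)"
      by (simp only: less.prems dir_deriv_0)
    also have "\<dots> = (scalar (of_nat (Suc k)) + 1) * dir_deriv a g + line_form u * dir_deriv a (dir_deriv a g)"
      by (simp add: dir_deriv_add dir_deriv_scalar_mult dir_deriv_line_form_mult assms(1) distrib_right
          del: of_nat_Suc)
    also have "scalar (of_nat (Suc k)) + 1 = scalar (of_nat (Suc (Suc k)))"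
      by (metis add.commute of_nat_Suc scalar_1 scalar_add)
    finally have "dir_deriv a g = 0"
      using less.hyps[OF _ super_piece_dir_deriv[OF less.prems(1)], of "Suc k" a] False by simp
    with less.prems have "scalar (of_nat (Suc k)) * g = 0" by simp
    then show ?thesis by (metis nat.distinct(1) of_nat_eq_0_iff scalar_mult_eq_0_iff)
  qed
qed

text \<open>In the splitting of \<open>f\<close> only the last summand has a derivative, namely
  \<open>g + line_form u * dir_deriv a g\<close>; that expression vanishes only for
  \<open>g = 0\<close>.\<close>

lemma super_piece_kernel:
  assumes "vec.subspace U" "u \<in> U" "dot a u = 1" "super_piece U i j f" "dir_deriv a f = 0"
  shows "\<exists>h0 h1. super_piece (U \<inter> {v. dot a v = 0}) i j h0 \<and>
    super_piece (U \<inter> {v. dot a v = 0}) i (j - 1) h1 \<and> f = h0 + theta_form u * h1"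
proof -
  obtain h0 h1 g where h: "super_piece (U \<inter> {v. dot a v = 0}) i j h0"
    "super_piece (U \<inter> {v. dot a v = 0}) i (j - 1) h1" "super_piece U (i - 1) j g"
    "f = h0 + theta_form u * h1 + line_form u * g"
    using super_piece_split[OF assms(1-4)] by blast
  have "dir_deriv a h0 = 0" "dir_deriv a h1 = 0"
    using h(1,2) by (auto intro: super_piece_annihilated)
  then have "scalar (of_nat (Suc 0)) * g + line_form u * dir_deriv a g = 0"
    using assms(3,5) by (simp add: h(4) dir_deriv_add dir_deriv_theta_form_mult dir_deriv_line_form_mult)
  then have "g = 0"
    using super_piece_euler_injective[OF assms(3) h(3)] by blast
  with h show ?thesis by auto
qed

text \<open>
  \<open>inverse_system_kernel a m\<close> is the set of elements annihilated by every composition of derivatives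
  along pairwise distinct forms among \<open>a 0, \<dots>, a (m - 1)\<close>, each bosonic or fermionic, followed by
  evaluation at the origin.
\<close>

primrec inverse_system_kernel :: "(nat \<Rightarrow> complex^'n::{finite,linorder}) \<Rightarrow> nat \<Rightarrow> 'n superspace set" where
  "inverse_system_kernel a 0 = {f. const_coeff f = 0}"
| "inverse_system_kernel a (Suc m) = {f \<in> inverse_system_kernel a m.
     dir_deriv (a m) f \<in> inverse_system_kernel a m \<and> contraction (a m) f \<in> inverse_system_kernel a m}"

lemma kernel_0 [simp]: "0 \<in> inverse_system_kernel a m"
  by (induction m) auto

lemma kernel_add:
  "f \<in> inverse_system_kernel a m \<Longrightarrow> g \<in> inverse_system_kernel a m \<Longrightarrow> f + g \<in> inverse_system_kernel a m"
  by (induction m arbitrary: f g) (auto simp: const_coeff_add dir_deriv_add contraction_add)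

lemma kernel_scale: "f \<in> inverse_system_kernel a m \<Longrightarrow> scalar c * f \<in> inverse_system_kernel a m"
  by (induction m arbitrary: f)
    (auto simp: const_coeff_scalar_mult dir_deriv_scalar_mult contraction_scalar_mult)

lemma kernel_minus: "f \<in> inverse_system_kernel a m \<Longrightarrow> - f \<in> inverse_system_kernel a m"
  using kernel_scale[of f a m "- 1"] by (simp add: scalar_minus_one_mult)

lemma kernel_diff:
  "f \<in> inverse_system_kernel a m \<Longrightarrow> g \<in> inverse_system_kernel a m \<Longrightarrow> f - g \<in> inverse_system_kernel a m"
  using kernel_add kernel_minus by fastforce

text \<open>By the product rules every derivative of the product is a combination of
  \<open>f\<close> and a multiple of a derivative of \<open>f\<close>; at the end, evaluation at the
  origin kills multiples of \<open>line_form v\<close>.\<close>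

lemma kernel_line: "f \<in> inverse_system_kernel a m \<Longrightarrow> line_form v * f \<in> inverse_system_kernel a m"
  by (induction m arbitrary: f)
    (auto simp: dir_deriv_line_form_mult contraction_line_form_mult kernel_add kernel_scale)

lemma kernel_theta: "f \<in> inverse_system_kernel a m \<Longrightarrow> theta_form v * f \<in> inverse_system_kernel a m"
  by (induction m arbitrary: f)
    (auto simp: dir_deriv_theta_form_mult contraction_theta_form_mult kernel_diff kernel_scale)

section \<open>Powers of linear forms in the kernel, and the ideal they generate\<close>

definition nonvanishing_count :: "(nat \<Rightarrow> complex^'n) \<Rightarrow> nat \<Rightarrow> complex^'n \<Rightarrow> nat" where
  "nonvanishing_count a m v = card {k. k < m \<and> dot (a k) v \<noteq> 0}"

lemma nonvanishing_count_0 [simp]: "nonvanishing_count a 0 v = 0"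
  by (simp add: nonvanishing_count_def)

lemma nonvanishing_count_Suc:
  "nonvanishing_count a (Suc m) v = nonvanishing_count a m v + (if dot (a m) v = 0 then 0 else 1)"
proof -
  have "{k. k < Suc m \<and> dot (a k) v \<noteq> 0} =
      {k. k < m \<and> dot (a k) v \<noteq> 0} \<union> (if dot (a m) v = 0 then {} else {m})"
    by (auto simp: less_Suc_eq)
  then show ?thesis by (auto simp: nonvanishing_count_def)
qed

text \<open>A derivative lowers the exponent by at most one, and only along a form not vanishing at
  \<open>v\<close>. The forms are used at most once each, so a factor \<open>line_form v\<close>
  survives until evaluation at the origin.\<close>

lemma kernel_line_power:
  "nonvanishing_count a m v < k \<Longrightarrow> line_form v ^ k * f \<in> inverse_system_kernel a m"
proof (induction m arbitrary: k f)
  case 0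
  then show ?case by (cases k) (auto simp: mult.assoc)
next
  case (Suc m)
  then obtain l where l: "k = Suc l" by (cases k) auto
  have le: "nonvanishing_count a m v < Suc l" "dot (a m) v \<noteq> 0 \<Longrightarrow> nonvanishing_count a m v < l"
    using Suc.prems by (auto simp: l nonvanishing_count_Suc)
  have "scalar (of_nat (Suc l) * dot (a m) v) * (line_form v ^ l * f) \<in> inverse_system_kernel a m"
    using Suc.IH[of l f] le by (cases "dot (a m) v = 0") (auto simp: kernel_scale)
  then have "dir_deriv (a m) (line_form v ^ k * f) \<in> inverse_system_kernel a m"
    unfolding l dir_deriv_line_form_power_mult using Suc.IH[OF le(1)] by (rule kernel_add)
  with Suc.IH le(1) show ?case
    by (auto simp: l contraction_line_form_power_mult simp del: power_Suc)
qed

text \<open>One power less is enough here. Either \<open>theta_form v\<close> survives until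
  evaluation, or it is consumed by a contraction along a form not vanishing at \<open>v\<close>;
  that form is then no longer available for lowering the exponent.\<close>

lemma kernel_line_power_theta:
  "nonvanishing_count a m v \<le> k \<Longrightarrow>
    line_form v ^ k * (theta_form v * f) \<in> inverse_system_kernel a m"
proof (induction m arbitrary: k f)
  case 0
  then show ?case by (cases k) (auto simp: mult.assoc)
next
  case (Suc m)
  have le: "nonvanishing_count a m v \<le> k" "dot (a m) v \<noteq> 0 \<Longrightarrow> nonvanishing_count a m v < k"
    using Suc.prems by (auto simp: nonvanishing_count_Suc split: if_splits)
  have "dir_deriv (a m) (line_form v ^ k * (theta_form v * f)) \<in> inverse_system_kernel a m"
  proof (cases k)
    case 0
    with Suc.IH[OF le(1)] show ?thesis by (simp add: dir_deriv_theta_form_mult)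
  next
    case (Suc l)
    have "scalar (of_nat (Suc l) * dot (a m) v) * (line_form v ^ l * (theta_form v * f))
        \<in> inverse_system_kernel a m"
      using Suc.IH[of l f] le Suc by (cases "dot (a m) v = 0") (auto simp: kernel_scale)
    then show ?thesis
      unfolding Suc dir_deriv_line_form_power_mult dir_deriv_theta_form_mult
      using Suc.IH[OF le(1)[unfolded Suc]] by (rule kernel_add)
  qed
  \<comment> \<open>This is what a contraction leaves when it consumes \<open>theta_form v\<close>.
    If its coefficient is nonzero, form \<open>m\<close> contributed to the count, so
    \<open>k\<close> strictly exceeds the count of the remaining forms.\<close>
  moreover have "scalar (dot (a m) v) * (line_form v ^ k * f) \<in> inverse_system_kernel a m"
    using kernel_line_power[of a m v k f] le(2) by (cases "dot (a m) v = 0") (auto simp: kernel_scale)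
  then have "contraction (a m) (line_form v ^ k * (theta_form v * f)) \<in> inverse_system_kernel a m"
    using Suc.IH[OF le(1)]
    by (simp add: contraction_line_form_power_mult contraction_theta_form_mult right_diff_distrib
        scalar_left_commute[of "line_form v ^ k"] kernel_diff)
  ultimately show ?case using Suc.IH[OF le(1)] by simp
qed

text \<open>The graded pieces of the ideal inside the subring for \<open>U\<close>. Right multiples
  suffice because \<open>line_form\<close> is central and \<open>theta_form\<close> anticommutes
  with its like. The rule \<open>theta\<close> omits the invertible factor \<open>Suc k\<close> of
  the Euler derivative.\<close>

inductive power_ideal ::
    "(nat \<Rightarrow> complex^'n::{finite,linorder}) \<Rightarrow> nat \<Rightarrow> (complex^'n::{finite,linorder}) set \<Rightarrow> int \<Rightarrow> int \<Rightarrow> 'n superspace \<Rightarrow> bool"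
  for a m U where
  zero [simp]: "power_ideal a m U i j 0"
| add: "power_ideal a m U i j f \<Longrightarrow> power_ideal a m U i j g \<Longrightarrow> power_ideal a m U i j (f + g)"
| line: "v \<in> U \<Longrightarrow> super_piece U i j f \<Longrightarrow> k = nonvanishing_count a m v \<Longrightarrow>
    power_ideal a m U (i + int (Suc k)) j (line_form v ^ Suc k * f)"
| theta: "v \<in> U \<Longrightarrow> super_piece U i j f \<Longrightarrow> k = nonvanishing_count a m v \<Longrightarrow>
    power_ideal a m U (i + int k) (j + 1) (line_form v ^ k * (theta_form v * f))"

lemma power_ideal_in_piece: "power_ideal a m U i j f \<Longrightarrow> super_piece U i j f"
  by (induction rule: power_ideal.induct)
    (auto simp del: power_Suc of_nat_Suc intro: super_piece.add super_piece_line_power super_piece.theta)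

lemma power_ideal_in_kernel: "power_ideal a m U i j f \<Longrightarrow> f \<in> inverse_system_kernel a m"
  by (induction rule: power_ideal.induct)
    (auto simp del: power_Suc intro: kernel_add kernel_line_power kernel_line_power_theta)

lemma power_ideal_theta_mult:
  "power_ideal a m U i j f \<Longrightarrow> u \<in> U \<Longrightarrow> power_ideal a m U i (j + 1) (theta_form u * f)"
proof (induction rule: power_ideal.induct)
  case (line v i j f k)
  then have "power_ideal a m U (i + int (Suc k)) (j + 1) (line_form v ^ Suc k * (theta_form u * f))"
    by (intro power_ideal.line super_piece.theta)
  then show ?case by (simp only: line_form_power_left_commute[of "theta_form u"])
next
  case (theta v i j f k)
  then have "power_ideal a m U (i + int k) (j + 1 + 1)
      (line_form v ^ k * (theta_form v * (- (theta_form u * f))))"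
    by (intro power_ideal.theta super_piece.theta super_piece_minus)
  then show ?case
    by (simp only: line_form_power_left_commute[of "theta_form u"] theta_form_anticommute[of u v]
        mult_minus_right)
qed (auto simp: distrib_left power_ideal.add)

text \<open>A form vanishing on \<open>W\<close> leaves the exponents of all \<open>v\<close> in
  \<open>W\<close> unchanged.\<close>

lemma power_ideal_Suc_mono:
  assumes "power_ideal a m W i j f" "W \<subseteq> U" "\<And>v. v \<in> W \<Longrightarrow> dot (a m) v = 0"
  shows "power_ideal a (Suc m) U i j f"
  using assms by (induction rule: power_ideal.induct)
    (auto simp del: power_Suc of_nat_Suc simp: nonvanishing_count_Suc
      intro!: power_ideal.add power_ideal.line power_ideal.theta intro: super_piece_mono)

text \<open>Preimages under the derivative can be chosen inside the ideal. If form \<open>m\<close>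
  vanishes at \<open>v\<close>, the exponent is unchanged and the cofactor is integrated along
  \<open>u\<close>. Otherwise the required exponent grows by one, and integrating by parts along
  \<open>v\<close> itself supplies the extra power.\<close>

lemma power_ideal_lift:
  assumes "u \<in> U" "dot (a m) u \<noteq> 0" "power_ideal a m U i j g"
  shows "\<exists>G. power_ideal a (Suc m) U (i + 1) j G \<and> dir_deriv (a m) G = g"
  using assms(3)
proof (induction rule: power_ideal.induct)
  case (zero i j)
  show ?case by (intro exI[of _ 0]) simp
next
  case (add i j f g)
  then show ?case by (metis dir_deriv_add power_ideal.add)
next
  case (line v i j f k)
  show ?case
  proof (cases "dot (a m) v = 0")
    case True
    obtain F where F: "super_piece U i j F" "dir_deriv (a m) (line_form u * F) = f"
      using super_piece_antiderivative[OF assms(1,2) line.hyps(2), of 0] by auto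
    have "power_ideal a (Suc m) U (i + 1 + int (Suc k)) j (line_form v ^ Suc k * (line_form u * F))"
      using line True F by (intro power_ideal.line super_piece.line)
        (auto simp: nonvanishing_count_Suc assms)
    moreover have "dir_deriv (a m) (line_form v ^ Suc k * (line_form u * F)) = line_form v ^ Suc k * f"
      using F(2) True by (simp only: dir_deriv_line_form_power_mult) simp
    ultimately show ?thesis by (metis add.assoc add.commute)
  next
    case False
    then obtain F where F: "super_piece U i j F"
        "dir_deriv (a m) (line_form v ^ Suc (Suc k) * F) = line_form v ^ Suc k * f"
      using super_piece_antiderivative[OF line.hyps(1) False line.hyps(2), of "Suc k"] by auto
    have "power_ideal a (Suc m) U (i + int (Suc (Suc k))) j (line_form v ^ Suc (Suc k) * F)"
      using line False F by (intro power_ideal.line) (auto simp: nonvanishing_count_Suc)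
    with F(2) show ?thesis by (metis add.assoc add.commute of_nat_Suc)
  qed
next
  case (theta v i j f k)
  show ?case
  proof (cases "dot (a m) v = 0")
    case True
    obtain F where F: "super_piece U i j F" "dir_deriv (a m) (line_form u * F) = f"
      using super_piece_antiderivative[OF assms(1,2) theta.hyps(2), of 0] by auto
    have "power_ideal a (Suc m) U (i + 1 + int k) (j + 1)
        (line_form v ^ k * (theta_form v * (line_form u * F)))"
      using theta True F by (intro power_ideal.theta super_piece.line)
        (auto simp: nonvanishing_count_Suc assms)
    moreover have "dir_deriv (a m) (line_form v ^ k * (theta_form v * (line_form u * F))) =
        line_form v ^ k * (theta_form v * f)"
      using F(2) True
      by (cases k) (simp_all only: dir_deriv_line_form_power_mult dir_deriv_theta_form_mult,
        simp_all add: dir_deriv_theta_form_mult)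
    ultimately show ?thesis by (metis add.assoc add.commute)
  next
    case False
    then obtain F where F: "super_piece U i j F"
        "dir_deriv (a m) (line_form v ^ Suc k * F) = line_form v ^ k * f"
      using super_piece_antiderivative[OF theta.hyps(1) False theta.hyps(2), of k] by auto
    have "power_ideal a (Suc m) U (i + int (Suc k)) (j + 1) (line_form v ^ Suc k * (theta_form v * F))"
      using theta False F by (intro power_ideal.theta) (auto simp: nonvanishing_count_Suc)
    moreover have "dir_deriv (a m) (line_form v ^ Suc k * (theta_form v * F)) =
        line_form v ^ k * (theta_form v * f)"
      using F(2) by (metis dir_deriv_theta_form_mult line_form_power_left_commute)
    ultimately show ?thesis by (metis add.assoc add.commute of_nat_Suc)
  qed
qed

section \<open>The common kernel is contained in the power ideal\<close>

lemma kernel_annihilated: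
  assumes "super_piece H i j f" "\<And>v. v \<in> H \<Longrightarrow> dot (a m) v = 0"
  shows "f \<in> inverse_system_kernel a (Suc m) \<longleftrightarrow> f \<in> inverse_system_kernel a m"
  using super_piece_annihilated[OF assms] by simp

text \<open>Contraction along form \<open>m\<close> kills \<open>h0\<close> and extracts
  \<open>h1\<close>. Once \<open>h1\<close> is known to lie in the kernel, subtracting
  \<open>theta_form u * h1\<close> isolates \<open>h0\<close>.\<close>

lemma kernel_sum_theta:
  assumes "dot (a m) u = 1" "\<And>v. v \<in> H \<Longrightarrow> dot (a m) v = 0"
    "super_piece H i j h0" "super_piece H i' j' h1"
  shows "h0 + theta_form u * h1 \<in> inverse_system_kernel a (Suc m) \<longleftrightarrow>
    h0 \<in> inverse_system_kernel a m \<and> h1 \<in> inverse_system_kernel a m"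
proof
  assume *: "h0 + theta_form u * h1 \<in> inverse_system_kernel a (Suc m)"
  have "contraction (a m) (h0 + theta_form u * h1) = h1"
    using super_piece_annihilated[OF assms(3,2)] super_piece_annihilated[OF assms(4,2)] assms(1)
    by (simp add: contraction_add contraction_theta_form_mult)
  with * have h1: "h1 \<in> inverse_system_kernel a m" by simp
  then have "h0 + theta_form u * h1 - theta_form u * h1 \<in> inverse_system_kernel a m"
    using * by (intro kernel_diff kernel_theta) auto
  with h1 show "h0 \<in> inverse_system_kernel a m \<and> h1 \<in> inverse_system_kernel a m" by simp
next
  assume "h0 \<in> inverse_system_kernel a m \<and> h1 \<in> inverse_system_kernel a m"
  then have "h0 \<in> inverse_system_kernel a (Suc m)" "h1 \<in> inverse_system_kernel a (Suc m)"
    using kernel_annihilated[of H _ _ _ a m] assms(2-4) by auto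
  then show "h0 + theta_form u * h1 \<in> inverse_system_kernel a (Suc m)"
    by (intro kernel_add kernel_theta)
qed

lemma subspace_Int_dot_kernel: "vec.subspace U \<Longrightarrow> vec.subspace (U \<inter> {v. dot a v = 0})"
  by (auto simp: vec.subspace_def dot_add_right dot_scale_right)

lemma obtain_dot_one:
  assumes "vec.subspace U" "\<not> (\<forall>v\<in>U. dot a v = 0)"
  obtains u where "u \<in> U" "dot a u = 1"
proof -
  obtain v where "v \<in> U" "dot a v \<noteq> 0" using assms(2) by auto
  then have "inverse (dot a v) *s v \<in> U" "dot a (inverse (dot a v) *s v) = 1"
    using assms(1) by (auto simp: dot_scale_right vec.subspace_scale)
  then show ?thesis using that by blast
qed

text \<open>Without forms all exponents are \<open>0\<close>, so \<open>line_form v\<close> and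
  \<open>theta_form v\<close> are themselves in the ideal and only constants remain modulo
  it.\<close>

lemma power_ideal_0_cong:
  "super_piece U i j f \<Longrightarrow> \<exists>c. power_ideal a 0 U i j (f - scalar c) \<and> (c = 0 \<or> i = 0 \<and> j = 0)"
proof (induction rule: super_piece.induct)
  case (scalar c)
  show ?case by (intro exI[of _ c]) simp
next
  case (zero i j)
  show ?case by (intro exI[of _ 0]) simp
next
  case (add i j f g)
  then obtain c d where "power_ideal a 0 U i j (f - scalar c)" "c = 0 \<or> i = 0 \<and> j = 0"
    "power_ideal a 0 U i j (g - scalar d)" "d = 0 \<or> i = 0 \<and> j = 0" by blast
  moreover from this have "power_ideal a 0 U i j ((f - scalar c) + (g - scalar d))"
    by (intro power_ideal.add)
  then have "power_ideal a 0 U i j (f + g - scalar (c + d))"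
    by (simp add: scalar_add algebra_simps)
  ultimately have "power_ideal a 0 U i j (f + g - scalar (c + d))" "c + d = 0 \<or> i = 0 \<and> j = 0"
    by (auto intro: power_ideal.add)
  then show ?case by blast
next
  case (line v i j f)
  then show ?case
    using power_ideal.line[of v U i j f 0 a 0] by (intro exI[of _ 0]) simp
next
  case (theta v i j f)
  then show ?case
    using power_ideal.theta[of v U i j f 0 a 0] by (intro exI[of _ 0]) simp
qed

text \<open>Induction on the number of forms, with \<open>U\<close> varying because the step passes
  to a hyperplane of \<open>U\<close>. The derivative of \<open>f\<close> is in the smaller ideal
  and lifts to some \<open>G\<close> in the ideal; the difference \<open>f - G\<close> has
  derivative \<open>0\<close>, so it comes from the hyperplane, where the induction hypothesis
  applies again.\<close>

lemma kernel_imp_power_ideal: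
  assumes "vec.subspace U" "super_piece U i j f" "f \<in> inverse_system_kernel a m"
  shows "power_ideal a m U i j f"
  using assms
proof (induction m arbitrary: U i j f)
  case 0
  then obtain c where c: "power_ideal a 0 U i j (f - scalar c)"
    using power_ideal_0_cong by blast
  \<comment> \<open>Ideal elements vanish at the origin, as does \<open>f\<close>, so the constant
    left over must be \<open>0\<close>.\<close>
  have "const_coeff (f - scalar c) = 0"
    using power_ideal_in_kernel[OF c] by simp
  then have "c = 0"
    using 0 const_coeff_add[of "f - scalar c" "scalar c"] by simp
  with c show ?case by simp
next
  case (Suc m)
  show ?case
  proof (cases "\<forall>v\<in>U. dot (a m) v = 0")
    case True
    then show ?thesis using Suc by (intro power_ideal_Suc_mono[of a m U]) auto
  next
    case False
    obtain u where u: "u \<in> U" "dot (a m) u = 1"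
      using obtain_dot_one[OF Suc.prems(1) False] .
    let ?H = "U \<inter> {v. dot (a m) v = 0}"
    have "power_ideal a m U (i - 1) j (dir_deriv (a m) f)"
      using Suc.prems by (intro Suc.IH super_piece_dir_deriv) auto
    then obtain G where G: "power_ideal a (Suc m) U i j G" "dir_deriv (a m) G = dir_deriv (a m) f"
      using power_ideal_lift[OF u(1), of a m "i - 1" j] u(2) by auto
    have "super_piece U i j (f - G)"
      using Suc.prems(2) power_ideal_in_piece[OF G(1)] by (rule super_piece_diff)
    moreover have "dir_deriv (a m) (f - G) = 0" using G(2) by (simp add: dir_deriv_diff)
    ultimately obtain h0 h1 where h: "super_piece ?H i j h0" "super_piece ?H i (j - 1) h1"
        "f - G = h0 + theta_form u * h1"
      using super_piece_kernel[OF Suc.prems(1) u] by blast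
    have "f - G \<in> inverse_system_kernel a (Suc m)"
      using Suc.prems(3) power_ideal_in_kernel[OF G(1)] by (rule kernel_diff)
    then have "h0 \<in> inverse_system_kernel a m" "h1 \<in> inverse_system_kernel a m"
      unfolding h(3) using kernel_sum_theta[of a m u ?H i j h0 i "j - 1" h1] u(2) h by auto
    then have "power_ideal a m ?H i j h0" "power_ideal a m ?H i (j - 1) h1"
      using Suc.IH subspace_Int_dot_kernel[OF Suc.prems(1)] h by auto
    then have "power_ideal a (Suc m) U i j h0" "power_ideal a (Suc m) U i (j - 1) h1"
      by (auto intro: power_ideal_Suc_mono[of a m ?H])
    then have "power_ideal a (Suc m) U i j (h0 + theta_form u * h1)"
      using power_ideal_theta_mult[of a "Suc m" U i "j - 1" h1 u] u(1)
      by (intro power_ideal.add) auto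
    then have "power_ideal a (Suc m) U i j (h0 + theta_form u * h1 + G)"
      using G(1) by (rule power_ideal.add)
    then show ?thesis by (simp flip: h(3))
  qed
qed

section \<open>Dimensions of the bigraded pieces\<close>

text \<open>Surplus entries of the longer list are dropped, exactly as \<open>combine\<close> does
  for rings; \<open>combine_superspace_ring\<close> identifies the two.\<close>

fun lincomb :: "complex list \<Rightarrow> 'n::{finite,linorder} superspace list \<Rightarrow> 'n superspace" where
  "lincomb (c # cs) (b # bs) = scalar c * b + lincomb cs bs"
| "lincomb _ _ = 0"

lemma lincomb_append:
  "length cs = length bs \<Longrightarrow> lincomb (cs @ cs') (bs @ bs') = lincomb cs bs + lincomb cs' bs'"
  by (induction cs bs rule: list_induct2) (auto simp: add.assoc)

lemma lincomb_zero: "set cs \<subseteq> {0} \<Longrightarrow> lincomb cs bs = 0"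
  by (induction cs bs rule: lincomb.induct) auto

lemma dir_deriv_lincomb: "dir_deriv a (lincomb cs bs) = lincomb cs (map (dir_deriv a) bs)"
  by (induction cs bs rule: lincomb.induct) (auto simp: dir_deriv_add dir_deriv_scalar_mult)

lemma theta_form_mult_lincomb: "theta_form u * lincomb cs bs = lincomb cs (map ((*) (theta_form u)) bs)"
  by (induction cs bs rule: lincomb.induct)
    (auto simp: distrib_left scalar_left_commute[of "theta_form u"])

lemma super_piece_lincomb:
  "(\<And>b. b \<in> set bs \<Longrightarrow> super_piece U i j b) \<Longrightarrow> super_piece U i j (lincomb cs bs)"
  by (induction cs bs rule: lincomb.induct) (auto intro: super_piece.add super_piece_scale)

text \<open>For subspaces \<open>M\<close> and \<open>N\<close>, the list represents a basis of
  \<open>M\<close> modulo \<open>M \<inter> N\<close>. Lists rather than sets make repetitions count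
  as dependent and let bases of sub and quotient be concatenated.\<close>

definition basis_modulo ::
    "'n::{finite,linorder} superspace set \<Rightarrow> 'n superspace set \<Rightarrow> 'n superspace list \<Rightarrow> bool" where
  "basis_modulo N M bs \<longleftrightarrow> set bs \<subseteq> M \<and>
     (\<forall>cs. length cs = length bs \<longrightarrow> lincomb cs bs \<in> N \<longrightarrow> set cs \<subseteq> {0}) \<and>
     (\<forall>f\<in>M. \<exists>cs. length cs = length bs \<and> f - lincomb cs bs \<in> N)"

lemma basis_moduloD:
  assumes "basis_modulo N M bs"
  shows "b \<in> set bs \<Longrightarrow> b \<in> M"
    and "length cs = length bs \<Longrightarrow> lincomb cs bs \<in> N \<Longrightarrow> set cs \<subseteq> {0}"
    and "f \<in> M \<Longrightarrow> \<exists>cs. length cs = length bs \<and> f - lincomb cs bs \<in> N"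
  using assms unfolding basis_modulo_def by blast+

text \<open>The deletion-contraction recursion read degree by degree: the three summands count lifts
  through the derivative, elements coming from the hyperplane, and their multiples by
  \<open>theta_form u\<close>.\<close>

primrec piece_dim :: "(nat \<Rightarrow> complex^'n) \<Rightarrow> nat \<Rightarrow> (complex^'n) set \<Rightarrow> int \<Rightarrow> int \<Rightarrow> nat" where
  "piece_dim a 0 U i j = (if i = 0 \<and> j = 0 then 1 else 0)"
| "piece_dim a (Suc m) U i j = (if \<forall>v\<in>U. dot (a m) v = 0 then piece_dim a m U i j
     else piece_dim a m U (i - 1) j + piece_dim a m (U \<inter> {v. dot (a m) v = 0}) i j +
       piece_dim a m (U \<inter> {v. dot (a m) v = 0}) i (j - 1))"

lemma basis_modulo_cong:
  assumes "\<And>f. f \<in> M \<Longrightarrow> f \<in> N \<longleftrightarrow> f \<in> N'" "basis_modulo N M bs"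
    "\<And>cs. lincomb cs bs \<in> M" "\<And>f g. f \<in> M \<Longrightarrow> g \<in> M \<Longrightarrow> f - g \<in> M"
  shows "basis_modulo N' M bs"
  unfolding basis_modulo_def
proof (intro conjI allI impI ballI)
  show "set bs \<subseteq> M" using basis_moduloD(1)[OF assms(2)] by auto
  show "set cs \<subseteq> {0}" if "length cs = length bs" "lincomb cs bs \<in> N'" for cs
    using basis_moduloD(2)[OF assms(2)] assms(1,3) that by simp
  show "\<exists>cs. length cs = length bs \<and> f - lincomb cs bs \<in> N'" if "f \<in> M" for f
    using basis_moduloD(3)[OF assms(2) that] assms(1,3,4) that by blast
qed

text \<open>
  With \<open>dot (a m) u = 1\<close> and \<open>H\<close> the part of \<open>U\<close> on which \<open>a m\<close> vanishes, \<open>dir_deriv (a m)\<close> induces a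
  surjection onto the quotient for \<open>a 0, \<dots>, a (m - 1)\<close> on \<open>U\<close>, with kernel the sum of the quotient for
  the same forms on \<open>H\<close> and its multiple by \<open>theta_form u\<close>.
\<close>

lemma basis_modulo_deletion_contraction:
  assumes U: "vec.subspace U" and u: "u \<in> U" "dot (a m) u = 1"
    and H: "H = U \<inter> {v. dot (a m) v = 0}"
    and bs: "basis_modulo (inverse_system_kernel a m) {f. super_piece U (i - 1) j f} bs"
    and b0: "basis_modulo (inverse_system_kernel a m) {f. super_piece H i j f} b0"
    and b1: "basis_modulo (inverse_system_kernel a m) {f. super_piece H i (j - 1) f} b1"
  shows "\<exists>ls. length ls = length bs \<and> basis_modulo (inverse_system_kernel a (Suc m))
    {f. super_piece U i j f} (ls @ b0 @ map ((*) (theta_form u)) b1)"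
proof -
  let ?K = "inverse_system_kernel a"
  have vanish: "v \<in> H \<Longrightarrow> dot (a m) v = 0" for v using H by simp
  have "\<exists>l. super_piece U i j l \<and> dir_deriv (a m) l = b" if "b \<in> set bs" for b
  proof -
    have "super_piece U (i - 1) j b" using basis_moduloD(1)[OF bs that] by simp
    then obtain F where "super_piece U (i - 1) j F" "dir_deriv (a m) (line_form u * F) = b"
      using super_piece_antiderivative[OF u(1), of "a m" "i - 1" j b 0] u(2) by auto
    then show ?thesis using super_piece_line'[OF u(1)] by blast
  qed
  then obtain l where l: "\<And>b. b \<in> set bs \<Longrightarrow> super_piece U i j (l b) \<and> dir_deriv (a m) (l b) = b"
    by metis
  let ?ls = "map l bs" and ?t1 = "map ((*) (theta_form u)) b1"
  have dls: "map (dir_deriv (a m)) ?ls = bs" using l by (auto intro: map_idI)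
  have p0: "super_piece H i j (lincomb cs b0)" and p1: "super_piece H i (j - 1) (lincomb cs b1)"
    and pl: "super_piece U i j (lincomb cs ?ls)" for cs
    using basis_moduloD(1)[OF b0] basis_moduloD(1)[OF b1] l by (auto intro!: super_piece_lincomb)
  have "set (?ls @ b0 @ ?t1) \<subseteq> {f. super_piece U i j f}"
    using l basis_moduloD(1)[OF b0] basis_moduloD(1)[OF b1] u(1) H
    by (auto intro!: super_piece_theta' intro: super_piece_mono)
  moreover have "set cs \<subseteq> {0}"
    if len: "length cs = length (?ls @ b0 @ ?t1)" and mem: "lincomb cs (?ls @ b0 @ ?t1) \<in> ?K (Suc m)" for cs
  proof -
    obtain c c0 c1 where c: "cs = c @ c0 @ c1" "length c = length bs" "length c0 = length b0"
        "length c1 = length b1"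
    proof -
      let ?n = "length bs" and ?k = "length b0"
      show thesis
        using len
        by (intro that[of "take ?n cs" "take ?k (drop ?n cs)" "drop ?k (drop ?n cs)"])
          (auto simp del: drop_drop)
    qed
    have eq: "lincomb cs (?ls @ b0 @ ?t1) = lincomb c ?ls + (lincomb c0 b0 + theta_form u * lincomb c1 b1)"
      using c by (simp add: lincomb_append theta_form_mult_lincomb)
    have "dir_deriv (a m) (lincomb c0 b0) = 0" "dir_deriv (a m) (lincomb c1 b1) = 0"
      using super_piece_annihilated(1)[OF p0 vanish] super_piece_annihilated(1)[OF p1 vanish] by auto
    \<comment> \<open>The derivative forgets the parts over \<open>H\<close> and turns the lifts
      back into \<open>bs\<close>, so the coefficients of the lifts vanish first.\<close>
    then have "dir_deriv (a m) (lincomb cs (?ls @ b0 @ ?t1)) = lincomb c bs"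
      unfolding eq
      by (simp add: dir_deriv_add dir_deriv_theta_form_mult dir_deriv_lincomb[of _ c] dls del: map_map)
    with mem have "lincomb c bs \<in> ?K m" by simp
    then have c0: "set c \<subseteq> {0}" using basis_moduloD(2)[OF bs c(2)] by simp
    then have "lincomb c ?ls = 0" by (rule lincomb_zero)
    then have "lincomb c0 b0 + theta_form u * lincomb c1 b1 \<in> ?K (Suc m)"
      using mem eq by simp
    then have "lincomb c0 b0 \<in> ?K m" "lincomb c1 b1 \<in> ?K m"
      using kernel_sum_theta[of a m u H, OF u(2) vanish p0 p1] by auto
    then show ?thesis
      using basis_moduloD(2)[OF b0 c(3)] basis_moduloD(2)[OF b1 c(4)] c0 c(1) by auto
  qed
  moreover have "\<exists>cs. length cs = length (?ls @ b0 @ ?t1) \<and> f - lincomb cs (?ls @ b0 @ ?t1) \<in> ?K (Suc m)"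
    if f: "super_piece U i j f" for f
  proof -
    obtain c where c: "length c = length bs" "dir_deriv (a m) f - lincomb c bs \<in> ?K m"
      using basis_moduloD(3)[OF bs, of "dir_deriv (a m) f"] super_piece_dir_deriv[OF f] by auto
    let ?g = "f - lincomb c ?ls"
    have g: "super_piece U i j ?g" using f pl by (rule super_piece_diff)
    have dg: "dir_deriv (a m) ?g = dir_deriv (a m) f - lincomb c bs"
      by (simp only: dir_deriv_diff dir_deriv_lincomb dls)
    \<comment> \<open>Knowing that the kernel coincides with the ideal is what provides a correction
      \<open>G\<close> inside the kernel with the same derivative as \<open>?g\<close>.\<close>
    have "power_ideal a m U (i - 1) j (dir_deriv (a m) ?g)"
      using c(2) by (intro kernel_imp_power_ideal U super_piece_dir_deriv g) (simp only: dg)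
    then obtain G where G: "power_ideal a (Suc m) U i j G" "dir_deriv (a m) G = dir_deriv (a m) ?g"
      using power_ideal_lift[OF u(1), of a m "i - 1" j] u(2) by auto
    have "super_piece U i j (?g - G)"
      using g power_ideal_in_piece[OF G(1)] by (rule super_piece_diff)
    moreover have "dir_deriv (a m) (?g - G) = 0" using G(2) by (simp add: dir_deriv_diff)
    ultimately obtain h0 h1 where h: "super_piece H i j h0" "super_piece H i (j - 1) h1"
        "?g - G = h0 + theta_form u * h1"
      unfolding H using super_piece_kernel[OF U u] by blast
    obtain c0 where c0: "length c0 = length b0" "h0 - lincomb c0 b0 \<in> ?K m"
      using basis_moduloD(3)[OF b0, of h0] h(1) by auto
    obtain c1 where c1: "length c1 = length b1" "h1 - lincomb c1 b1 \<in> ?K m"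
      using basis_moduloD(3)[OF b1, of h1] h(2) by auto
    have "f - lincomb (c @ c0 @ c1) (?ls @ b0 @ ?t1) =
        G + ((h0 - lincomb c0 b0) + theta_form u * (h1 - lincomb c1 b1))"
    proof -
      have "f = lincomb c ?ls + (h0 + theta_form u * h1 + G)"
        using h(3) by (metis add.commute diff_add_cancel)
      moreover have "lincomb (c @ c0 @ c1) (?ls @ b0 @ ?t1) =
          lincomb c ?ls + (lincomb c0 b0 + theta_form u * lincomb c1 b1)"
        using c c0 c1 by (simp add: lincomb_append theta_form_mult_lincomb)
      ultimately show ?thesis by (simp add: algebra_simps)
    qed
    moreover have "(h0 - lincomb c0 b0) + theta_form u * (h1 - lincomb c1 b1) \<in> ?K (Suc m)"
      using kernel_sum_theta[of a m u H, OF u(2) vanish super_piece_diff[OF h(1) p0]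
          super_piece_diff[OF h(2) p1]] c0(2) c1(2) by auto
    ultimately have "f - lincomb (c @ c0 @ c1) (?ls @ b0 @ ?t1) \<in> ?K (Suc m)"
      using kernel_add power_ideal_in_kernel[OF G(1)] by metis
    then show ?thesis using c c0 c1 by (intro exI[of _ "c @ c0 @ c1"]) auto
  qed
  ultimately have "basis_modulo (?K (Suc m)) {f. super_piece U i j f} (?ls @ b0 @ ?t1)"
    unfolding basis_modulo_def by simp
  then show ?thesis by (intro exI[of _ ?ls]) simp
qed

lemma const_coeff_super_piece: "super_piece U i j f \<Longrightarrow> const_coeff f = 0 \<or> i = 0 \<and> j = 0"
  by (induction rule: super_piece.induct) (auto simp: const_coeff_add)

text \<open>A form vanishing on \<open>U\<close> changes nothing; any other form calls for bases
  over both \<open>U\<close> and its hyperplane, hence the induction for all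
  \<open>U\<close>.\<close>

lemma basis_modulo_kernel:
  assumes "vec.subspace U"
  shows "\<exists>bs. length bs = piece_dim a m U i j \<and>
    basis_modulo (inverse_system_kernel a m) {f. super_piece U i j f} bs"
  using assms
proof (induction m arbitrary: U i j)
  case 0
  show ?case
  proof (cases "i = 0 \<and> j = 0")
    case True
    have "basis_modulo (inverse_system_kernel a 0) {f. super_piece U 0 0 f} [1]"
      unfolding basis_modulo_def
    proof (intro conjI allI impI ballI)
      show "set [1] \<subseteq> {f. super_piece U 0 0 f}"
        using super_piece.scalar[of U 1] by simp
      fix cs :: "complex list"
      assume "length cs = length [1 :: 'a superspace]"
      then obtain c where "cs = [c]" by (auto simp: length_Suc_conv)
      moreover assume "lincomb cs [1] \<in> inverse_system_kernel a 0"
      ultimately show "set cs \<subseteq> {0}" by simp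
    next
      fix f :: "'a superspace"
      show "\<exists>cs. length cs = length [1 :: 'a superspace] \<and> f - lincomb cs [1] \<in> inverse_system_kernel a 0"
        using const_coeff_add[of "f - scalar (const_coeff f)" "scalar (const_coeff f)"]
        by (intro exI[of _ "[const_coeff f]"]) simp
    qed
    with True show ?thesis by (intro exI[of _ "[1]"]) simp
  next
    case False
    then have "basis_modulo (inverse_system_kernel a 0) {f. super_piece U i j f} []"
      using const_coeff_super_piece by (auto simp: basis_modulo_def)
    with False show ?thesis by (intro exI[of _ "[]"]) auto
  qed
next
  case (Suc m)
  show ?case
  proof (cases "\<forall>v\<in>U. dot (a m) v = 0")
    case True
    obtain bs where bs: "length bs = piece_dim a m U i j"
        "basis_modulo (inverse_system_kernel a m) {f. super_piece U i j f} bs"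
      using Suc by blast
    have "basis_modulo (inverse_system_kernel a (Suc m)) {f. super_piece U i j f} bs"
    proof (rule basis_modulo_cong[OF _ bs(2)])
      show "f \<in> inverse_system_kernel a m \<longleftrightarrow> f \<in> inverse_system_kernel a (Suc m)"
        if "f \<in> {f. super_piece U i j f}" for f
        using kernel_annihilated[of U i j f a m] True that by auto
      show "lincomb cs bs \<in> {f. super_piece U i j f}" for cs
        using basis_moduloD(1)[OF bs(2)] by (auto intro!: super_piece_lincomb)
    qed (auto intro: super_piece_diff)
    with bs(1) True show ?thesis by auto
  next
    case False
    obtain u where u: "u \<in> U" "dot (a m) u = 1"
      using obtain_dot_one[OF Suc.prems False] .
    let ?H = "U \<inter> {v. dot (a m) v = 0}"
    let ?B = "\<lambda>U i j. basis_modulo (inverse_system_kernel a m) {f. super_piece U i j f}"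
    obtain bs b0 b1 where
      "length bs = piece_dim a m U (i - 1) j" "?B U (i - 1) j bs"
      "length b0 = piece_dim a m ?H i j" "?B ?H i j b0"
      "length b1 = piece_dim a m ?H i (j - 1)" "?B ?H i (j - 1) b1"
      using Suc.IH[OF Suc.prems] Suc.IH[OF subspace_Int_dot_kernel[OF Suc.prems]] by metis
    moreover from this obtain ls where "length ls = length bs"
        "basis_modulo (inverse_system_kernel a (Suc m)) {f. super_piece U i j f}
          (ls @ b0 @ map ((*) (theta_form u)) b1)"
      using basis_modulo_deletion_contraction[of U u a m ?H i j bs b0 b1] Suc.prems u by metis
    ultimately show ?thesis
      using False by (intro exI[of _ "ls @ b0 @ map ((*) (theta_form u)) b1"]) auto
  qed
qed

section \<open>Comparison with the bigrading by monomials\<close>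

definition super_monomial :: "'n set \<Rightarrow> ('n \<Rightarrow>\<^sub>0 nat) \<Rightarrow> complex \<Rightarrow> 'n superspace" where
  "super_monomial S e c = Superspace (\<lambda>T. if T = S then Poly_Mapping.single e c else 0)"

lemma poly_mapping_sum_single:
  "p = (\<Sum>e\<in>Poly_Mapping.keys p. Poly_Mapping.single e (Poly_Mapping.lookup p e))"
proof (rule poly_mapping_eqI)
  fix d
  have "(\<Sum>e\<in>Poly_Mapping.keys p. Poly_Mapping.lookup (Poly_Mapping.single e (Poly_Mapping.lookup p e)) d) =
      (\<Sum>e\<in>Poly_Mapping.keys p. if e = d then Poly_Mapping.lookup p d else 0)"
    by (intro sum.cong) (auto simp: lookup_single when_def)
  also have "\<dots> = Poly_Mapping.lookup p d" by (simp add: in_keys_iff)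
  finally show "Poly_Mapping.lookup p d =
      Poly_Mapping.lookup (\<Sum>e\<in>Poly_Mapping.keys p. Poly_Mapping.single e (Poly_Mapping.lookup p e)) d"
    by (simp add: lookup_sum)
qed

lemma superspace_sum_monomials:
  fixes f :: "'n::{finite,linorder} superspace"
  shows "f = (\<Sum>S\<in>UNIV. \<Sum>e\<in>Poly_Mapping.keys (theta_coeff f S).
    super_monomial S e (Poly_Mapping.lookup (theta_coeff f S) e))"
proof (rule superspace_eqI)
  fix T
  have "theta_coeff (\<Sum>S\<in>UNIV. \<Sum>e\<in>Poly_Mapping.keys (theta_coeff f S).
      super_monomial S e (Poly_Mapping.lookup (theta_coeff f S) e)) T =
    (\<Sum>S\<in>UNIV. if S = T then theta_coeff f T else 0)"
    unfolding theta_coeff_sum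
  proof (intro sum.cong refl)
    fix S
    show "(\<Sum>e\<in>Poly_Mapping.keys (theta_coeff f S).
        theta_coeff (super_monomial S e (Poly_Mapping.lookup (theta_coeff f S) e)) T) =
      (if S = T then theta_coeff f T else 0)"
      using poly_mapping_sum_single[of "theta_coeff f T"]
      by (cases "S = T") (auto simp: super_monomial_def)
  qed
  then show "theta_coeff f T = theta_coeff (\<Sum>S\<in>UNIV. \<Sum>e\<in>Poly_Mapping.keys (theta_coeff f S).
      super_monomial S e (Poly_Mapping.lookup (theta_coeff f S) e)) T"
    by simp
qed

text \<open>A monomial is assembled one variable at a time, first the fermionic ones by induction on
  \<open>S\<close>, then the bosonic ones by induction on the degree.\<close>

lemma super_piece_monomial:
  fixes S :: "'n::{finite,linorder} set"
  shows "super_piece UNIV (int (\<Sum>k\<in>UNIV. Poly_Mapping.lookup e k)) (int (card S)) (super_monomial S e c)"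
proof (induction "\<Sum>k\<in>UNIV. Poly_Mapping.lookup e k" arbitrary: e)
  case 0
  then have e: "e = 0" by (intro poly_mapping_eqI) simp
  have "super_piece UNIV 0 (int (card S)) (super_monomial S 0 c)"
    using finite[of S]
  proof (induction S arbitrary: c rule: finite_induct)
    case empty
    have "super_monomial {} 0 c = (scalar c :: 'n superspace)"
      by (simp add: super_monomial_def scalar_def of_poly_def)
    then show ?case using super_piece.scalar[of UNIV c] by simp
  next
    case (insert j S)
    \<comment> \<open>The constant \<open>d\<close> is \<open>c\<close> or \<open>- c\<close>,
      chosen to absorb the sign of inserting \<open>j\<close>.\<close>
    obtain d where d: "theta_sign {j} S * Poly_Mapping.single 0 d = Poly_Mapping.single 0 c"
      using theta_sign_cases[of "{j}" S]
      by (metis mult_1 mult_minus1 minus_minus single_uminus)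
    have "super_monomial (insert j S) 0 c = fermionic j * super_monomial S 0 d"
      using insert.hyps(2) d
      by (intro superspace_eqI) (auto simp: super_monomial_def theta_coeff_fermionic_mult)
    also have "\<dots> = theta_form (axis j 1) * super_monomial S 0 d"
      by (simp add: theta_form_axis)
    finally show ?case
      using insert super_piece.theta[of "axis j 1" UNIV 0 "int (card S)"] by (simp add: add.commute)
  qed
  with e show ?case by simp
next
  case (Suc n)
  then obtain i where i: "Poly_Mapping.lookup e i \<noteq> 0"
    by (metis Zero_neq_Suc sum.neutral)
  define e' where "e' = e - Poly_Mapping.single i 1"
  have e: "e = Poly_Mapping.single i 1 + e'"
    using i unfolding e'_def
    by (intro poly_mapping_eqI) (auto simp: lookup_add lookup_minus lookup_single when_def)
  have sum: "(\<Sum>k\<in>UNIV. Poly_Mapping.lookup e k) = Suc (\<Sum>k\<in>UNIV. Poly_Mapping.lookup e' k)"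
    by (simp add: e lookup_add lookup_single sum.distrib when_def)
  have "super_monomial S e c = bosonic i * super_monomial S e' c"
    by (rule superspace_eqI) (simp add: super_monomial_def bosonic_def e mult_single)
  also have "\<dots> = line_form (axis i 1) * super_monomial S e' c"
    by (simp add: line_form_axis)
  finally show ?case
    using super_piece.line[of "axis i 1" UNIV, OF _ Suc.hyps(1)[of e']] Suc.hyps(2)
    by (simp add: sum add.commute)
qed

lemma super_piece_sum: "(\<And>x. x \<in> A \<Longrightarrow> super_piece U i j (f x)) \<Longrightarrow> super_piece U i j (sum f A)"
  by (induction A rule: infinite_finite_induct) (auto intro: super_piece.add)

lemma bidegree_part_0 [simp]: "0 \<in> bidegree_part i j"
  by (simp add: bidegree_part_def)

lemma bidegree_part_add:
  "f \<in> bidegree_part i j \<Longrightarrow> g \<in> bidegree_part i j \<Longrightarrow> f + g \<in> bidegree_part i j"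
  using keys_add[of "theta_coeff f _" "theta_coeff g _"] unfolding bidegree_part_def by fastforce

lemma bidegree_part_sum:
  "(\<And>x. x \<in> A \<Longrightarrow> f x \<in> bidegree_part i j) \<Longrightarrow> sum f A \<in> bidegree_part i j"
  by (induction A rule: infinite_finite_induct) (auto intro: bidegree_part_add)

lemma bidegree_part_monomial_mult:
  fixes f :: "'n::{finite,linorder} superspace"
  assumes "f \<in> bidegree_part i j" "i' = (\<Sum>k\<in>UNIV. Poly_Mapping.lookup e k) + i"
  shows "of_poly (Poly_Mapping.single e c) * f \<in> bidegree_part i' j"
proof -
  have "d \<in> (\<lambda>b. e + b) ` Poly_Mapping.keys p"
    if "d \<in> Poly_Mapping.keys (Poly_Mapping.single e c * p)" for d and p :: "'n cpoly"
    using that keys_mult[of "Poly_Mapping.single e c" p] by (auto split: if_splits)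
  then show ?thesis
    using assms by (fastforce simp: bidegree_part_def lookup_add sum.distrib)
qed

lemma bidegree_part_scale: "f \<in> bidegree_part i j \<Longrightarrow> scalar c * f \<in> bidegree_part i j"
  unfolding scalar_def by (rule bidegree_part_monomial_mult) auto

lemma bidegree_part_fermionic_mult:
  fixes f :: "'n::{finite,linorder} superspace"
  assumes "f \<in> bidegree_part i j"
  shows "fermionic k * f \<in> bidegree_part i (Suc j)"
  unfolding bidegree_part_def
proof (intro CollectI allI ballI)
  fix S d
  assume d: "d \<in> Poly_Mapping.keys (theta_coeff (fermionic k * f) S)"
  then have k: "k \<in> S" by (auto simp: theta_coeff_fermionic_mult split: if_splits)
  have "Poly_Mapping.keys (- p) = Poly_Mapping.keys p" for p :: "'n cpoly"
    by (auto simp: in_keys_iff)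
  then have "Poly_Mapping.keys (theta_sign {k} (S - {k}) * p) = Poly_Mapping.keys p" for p
    using theta_sign_cases[of "{k}" "S - {k}"] by auto
  then have "d \<in> Poly_Mapping.keys (theta_coeff f (S - {k}))"
    using d k by (simp add: theta_coeff_fermionic_mult)
  then have "(\<Sum>l\<in>UNIV. Poly_Mapping.lookup d l) = i" "card (S - {k}) = j"
    using assms by (auto simp: bidegree_part_def)
  moreover have "card S = Suc (card (S - {k}))" using card_Suc_Diff1[OF finite k] by simp
  ultimately show "(\<Sum>l\<in>UNIV. Poly_Mapping.lookup d l) = i \<and> card S = Suc j" by simp
qed

text \<open>The alternative \<open>f = 0\<close> takes care of negative degrees, which
  \<open>nat\<close> would send to degree \<open>0\<close>.\<close>

lemma super_piece_imp_bidegree_part: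
  "super_piece U i j f \<Longrightarrow> f = 0 \<or> 0 \<le> i \<and> 0 \<le> j \<and> f \<in> bidegree_part (nat i) (nat j)"
proof (induction rule: super_piece.induct)
  case (scalar c)
  have "(1 :: 'a superspace) \<in> bidegree_part 0 0"
    by (auto simp: bidegree_part_def one_superspace.rep_eq split: if_splits)
  from bidegree_part_scale[OF this, of c] show ?case by simp
next
  case (add i j f g)
  then show ?case by (auto intro: bidegree_part_add)
next
  case (line v i j f)
  have "line_form v * f \<in> bidegree_part (nat (i + 1)) (nat j)"
    if "0 \<le> i" "f \<in> bidegree_part (nat i) (nat j)"
    unfolding line_form_mult bosonic_def using that
    by (intro bidegree_part_sum bidegree_part_scale bidegree_part_monomial_mult[of f "nat i"])
      (auto simp: lookup_single when_def)
  with line show ?case by auto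
next
  case (theta v i j f)
  have "theta_form v * f \<in> bidegree_part (nat i) (nat (j + 1))"
    if "0 \<le> j" "f \<in> bidegree_part (nat i) (nat j)"
  proof -
    have "nat (j + 1) = Suc (nat j)" using that by simp
    then show ?thesis
      unfolding theta_form_mult using that
      by (auto intro!: bidegree_part_sum bidegree_part_scale bidegree_part_fermionic_mult)
  qed
  with theta show ?case by auto
qed simp

lemma bidegree_part_eq_super_piece: "bidegree_part i j = {f. super_piece UNIV (int i) (int j) f}"
proof (intro equalityI subsetI)
  fix f :: "'a superspace"
  assume f: "f \<in> bidegree_part i j"
  have "super_piece UNIV (int i) (int j) (super_monomial S e c)"
    if "e \<in> Poly_Mapping.keys (theta_coeff f S)" for S e c
    using f that super_piece_monomial[of e S c] by (auto simp: bidegree_part_def)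
  then show "f \<in> {f. super_piece UNIV (int i) (int j) f}"
    by (subst superspace_sum_monomials) (auto intro!: super_piece_sum)
next
  fix f :: "'a superspace"
  assume "f \<in> {f. super_piece UNIV (int i) (int j) f}"
  then show "f \<in> bidegree_part i j"
    using super_piece_imp_bidegree_part[of UNIV "int i" "int j" f] by auto
qed

section \<open>Identification of the ideal of the arrangement with the kernel\<close>

lemma kernel_sum: "(\<And>x. x \<in> A \<Longrightarrow> f x \<in> inverse_system_kernel a m) \<Longrightarrow> sum f A \<in> inverse_system_kernel a m"
  by (induction A rule: infinite_finite_induct) (auto intro: kernel_add)

text \<open>An arbitrary multiplier is a sum of monomials, and each monomial is built from the
  linear factors under which the kernel is already closed.\<close>

lemma kernel_left_ideal: "f \<in> inverse_system_kernel a m \<Longrightarrow> g * f \<in> inverse_system_kernel a m"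
proof -
  assume f: "f \<in> inverse_system_kernel a m"
  have "g * f \<in> inverse_system_kernel a m" if "super_piece UNIV i j g" for i j g
    using that by (induction rule: super_piece.induct)
      (auto simp: f distrib_right mult.assoc kernel_scale kernel_add kernel_line kernel_theta)
  then show ?thesis
    by (subst superspace_sum_monomials[of g])
      (auto simp: sum_distrib_right intro!: kernel_sum super_piece_monomial)
qed

lemma super_deriv_eq_dir_deriv: "super_deriv i f = dir_deriv (axis i 1) f"
proof -
  have "dir_deriv (axis i 1) f = (\<Sum>j\<in>UNIV. if j = i then super_deriv i f else 0)"
    unfolding dir_deriv_def by (intro sum.cong) (auto simp: axis_def)
  then show ?thesis by simp
qed

text \<open>The chain rule: the partial derivatives of \<open>line_form v\<close> are the
  coordinates of \<open>v\<close>, and they recombine to \<open>theta_form v\<close>.\<close>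

lemma euler_op_line_form_power:
  "euler_op (line_form v ^ Suc k) = scalar (of_nat (Suc k)) * (line_form v ^ k * theta_form v)"
proof -
  have d1: "dir_deriv (axis i 1) 1 = 0" for i :: 'a
    using dir_deriv_scalar[of "axis i 1" 1] by simp
  have "super_deriv i (line_form v ^ Suc k) = scalar (of_nat (Suc k) * v $ i) * line_form v ^ k" for i
    using dir_deriv_line_form_power_mult[of "axis i 1" v k 1]
    by (simp add: super_deriv_eq_dir_deriv d1 del: power_Suc of_nat_Suc)
  then show ?thesis
    by (simp add: euler_op_def theta_form_def sum_distrib_left mult.assoc scalar_mult
        scalar_left_commute[of "line_form v ^ k"] del: power_Suc of_nat_Suc)
qed

lemma superspace_ring_simps [simp]:
  "carrier superspace_ring = UNIV" "mult superspace_ring = (*)" "one superspace_ring = 1"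
  "zero superspace_ring = 0" "add superspace_ring = (+)"
  by (simp_all add: superspace_ring_def)

lemma superspace_ring_a_inv [simp]: "a_inv superspace_ring f = - f"
proof -
  interpret ring superspace_ring by (rule ring_superspace_ring)
  show ?thesis using minus_equality[of "- f" f] by simp
qed

lemma ideal_superspaceI:
  assumes "0 \<in> N" "\<And>f g. f \<in> N \<Longrightarrow> g \<in> N \<Longrightarrow> f + g \<in> N" "\<And>f g. f \<in> N \<Longrightarrow> g * f \<in> N"
    "\<And>f g. f \<in> N \<Longrightarrow> f * g \<in> N"
  shows "ideal N superspace_ring"
proof (rule idealI[OF ring_superspace_ring])
  have "- f \<in> N" if "f \<in> N" for f
    using assms(3)[OF that, of "- 1"] by simp
  then have inv: "inv\<^bsub>add_monoid superspace_ring\<^esub> f \<in> N" if "f \<in> N" for f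
    using that by (metis a_inv_def superspace_ring_a_inv)
  have "group (add_monoid (superspace_ring :: 'a superspace ring))"
    by (intro abelian_group.a_group ring.is_abelian_group ring_superspace_ring)
  then show "subgroup N (add_monoid superspace_ring)"
    by (rule group.subgroupI) (use inv assms(1,2) in \<open>auto simp only:, auto\<close>)
qed (use assms in auto)

context
  fixes \<A> :: "(complex^'n::{finite,linorder}) set list" and a :: "nat \<Rightarrow> complex^'n::{finite,linorder}" and m :: nat
  assumes m: "m = length \<A>"
    and a: "\<And>k. k < m \<Longrightarrow> \<A> ! k = {v. dot (a k) v = 0}"
begin

lemma line_count_eq: "line_count \<A> (vec.span {v}) = nonvanishing_count a m v"
proof -
  have "vec.span {v} \<subseteq> \<A> ! k \<longleftrightarrow> dot (a k) v = 0" if "k < m" for k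
  proof
    assume "vec.span {v} \<subseteq> \<A> ! k"
    then show "dot (a k) v = 0" using a[OF that] vec.span_base[of v "{v}"] by auto
  next
    assume "dot (a k) v = 0"
    then show "vec.span {v} \<subseteq> \<A> ! k"
      unfolding a[OF that] using subspace_Int_dot_kernel[of UNIV "a k"]
      by (intro vec.span_minimal) (auto simp: vec.subspace_UNIV)
  qed
  then show ?thesis
    unfolding line_count_def nonvanishing_count_def m by (intro arg_cong[of _ _ card]) auto
qed

lemma ideal_gens_iff:
  "g \<in> ideal_gens \<A> \<longleftrightarrow> (\<exists>v. v \<noteq> 0 \<and> (let k = nonvanishing_count a m v in
     g = line_form v ^ Suc k \<or> g = scalar (of_nat (Suc k)) * (line_form v ^ k * theta_form v)))"
  unfolding ideal_gens_def Let_def Suc_eq_plus1[symmetric] euler_op_line_form_power line_count_eq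
  by auto

text \<open>The set \<open>?N\<close> of elements all of whose right multiples lie in the kernel is
  closed on the right by construction and on the left by \<open>kernel_left_ideal\<close>. It is
  thus a two-sided ideal containing the generators, and taking \<open>1\<close> as multiplier places
  it in the kernel.\<close>

lemma super_ideal_subset_kernel: "super_ideal \<A> \<subseteq> inverse_system_kernel a m"
proof -
  let ?N = "{f. \<forall>g. f * g \<in> inverse_system_kernel a m}"
  have "ideal ?N superspace_ring"
    by (rule ideal_superspaceI) (auto simp: distrib_right mult.assoc kernel_add kernel_left_ideal)
  moreover have "ideal_gens \<A> \<subseteq> ?N"
  proof (intro subsetI CollectI allI)
    fix x g
    assume "x \<in> ideal_gens \<A>"
    then obtain v k where k: "k = nonvanishing_count a m v"
      and "x = line_form v ^ Suc k \<or> x = scalar (of_nat (Suc k)) * (line_form v ^ k * theta_form v)"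
      unfolding ideal_gens_iff Let_def by blast
    then show "x * g \<in> inverse_system_kernel a m"
    proof (elim disjE)
      assume "x = line_form v ^ Suc k"
      then show ?thesis using kernel_line_power[of a m v "Suc k" g] k by simp
    next
      assume "x = scalar (of_nat (Suc k)) * (line_form v ^ k * theta_form v)"
      then have "x * g = scalar (of_nat (Suc k)) * (line_form v ^ k * (theta_form v * g))"
        by (simp only: mult.assoc)
      then show ?thesis using kernel_line_power_theta[of a m v k g] k by (simp only: kernel_scale order_refl)
    qed
  qed
  ultimately have "super_ideal \<A> \<subseteq> ?N"
    unfolding super_ideal_def by (rule ring.genideal_minimal[OF ring_superspace_ring])
  then have "f * 1 \<in> inverse_system_kernel a m" if "f \<in> super_ideal \<A>" for f
    using that by blast
  then show ?thesis by auto
qed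

lemma super_ideal_closed:
  "0 \<in> super_ideal \<A>"
  "f \<in> super_ideal \<A> \<Longrightarrow> g \<in> super_ideal \<A> \<Longrightarrow> f + g \<in> super_ideal \<A>"
  "f \<in> super_ideal \<A> \<Longrightarrow> h * f \<in> super_ideal \<A>"
  "f \<in> super_ideal \<A> \<Longrightarrow> f * h \<in> super_ideal \<A>"
  using additive_subgroup.zero_closed[OF ideal.axioms(1)[OF ideal_super_ideal[of \<A>]]]
    additive_subgroup.a_closed[OF ideal.axioms(1)[OF ideal_super_ideal[of \<A>]], of f g]
    ideal.I_l_closed[OF ideal_super_ideal[of \<A>], of f h]
    ideal.I_r_closed[OF ideal_super_ideal[of \<A>], of f h]
  by simp_all

lemma ideal_gens_in_super_ideal: "g \<in> ideal_gens \<A> \<Longrightarrow> g \<in> super_ideal \<A>"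
  unfolding super_ideal_def using ring.genideal_self[OF ring_superspace_ring, of "ideal_gens \<A>"] by auto

lemma power_ideal_in_super_ideal: "power_ideal a m U i j f \<Longrightarrow> f \<in> super_ideal \<A>"
proof (induction rule: power_ideal.induct)
  case (line v i j f k)
  have "line_form v ^ Suc k \<in> super_ideal \<A>"
  \<comment> \<open>The zero vector gives no element of \<open>ideal_gens\<close>, but the
    corresponding element is \<open>0\<close>.\<close>
  proof (cases "v = 0")
    case True
    then show ?thesis by (simp add: line_form_def super_ideal_closed)
  next
    case False
    with line show ?thesis by (auto intro!: ideal_gens_in_super_ideal simp: ideal_gens_iff Let_def)
  qed
  then show ?case by (rule super_ideal_closed)
next
  case (theta v i j f k)
  have "line_form v ^ k * theta_form v \<in> super_ideal \<A>"
  proof (cases "v = 0")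
    case True
    then show ?thesis by (simp add: theta_form_def super_ideal_closed)
  next
    case False
    let ?c = "of_nat (Suc k) :: complex"
    have "scalar ?c * (line_form v ^ k * theta_form v) \<in> super_ideal \<A>"
      using False theta by (auto intro!: ideal_gens_in_super_ideal simp: ideal_gens_iff Let_def)
    then have "scalar (inverse ?c) * (scalar ?c * (line_form v ^ k * theta_form v)) \<in> super_ideal \<A>"
      by (rule super_ideal_closed)
    moreover have "scalar (inverse ?c) * (scalar ?c * x) = x" for x :: "'n superspace"
      by (simp del: of_nat_Suc flip: mult.assoc scalar_mult)
    ultimately show ?thesis by simp
  qed
  then have "line_form v ^ k * theta_form v * f \<in> super_ideal \<A>" by (rule super_ideal_closed)
  then show ?case by (simp add: mult.assoc)
qed (auto intro: super_ideal_closed)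

text \<open>Only bihomogeneous elements are compared, because the inclusion of the kernel in the
  ideal was proved piece by piece.\<close>

lemma super_ideal_iff_kernel:
  "f \<in> bidegree_part i j \<Longrightarrow> f \<in> super_ideal \<A> \<longleftrightarrow> f \<in> inverse_system_kernel a m"
  unfolding bidegree_part_eq_super_piece
  using super_ideal_subset_kernel power_ideal_in_super_ideal
    kernel_imp_power_ideal[OF vec.subspace_UNIV] by blast

end

section \<open>Dimensions in the quotient ring\<close>

lemma combine_superspace_ring:
  "ring.combine superspace_ring (map scalar cs) bs = lincomb cs bs"
proof -
  interpret ring superspace_ring by (rule ring_superspace_ring)
  show ?thesis by (induction cs bs rule: lincomb.induct) auto
qed

lemma subfield_range_scalar: "subfield (range scalar) (superspace_ring :: 'n::{finite,linorder} superspace ring)"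
proof -
  interpret ring "superspace_ring :: 'n superspace ring" by (rule ring_superspace_ring)
  have inj: "scalar c = scalar d \<longleftrightarrow> c = d" for c d
    by (metis const_coeff_scalar)
  show ?thesis
  proof (intro subfieldI subcringI subringI)
    show "\<one>\<^bsub>superspace_ring\<^esub> \<in> range scalar" using scalar_1 by (metis rangeI superspace_ring_simps(3))
    show "\<ominus>\<^bsub>superspace_ring\<^esub> h \<in> range scalar"
      if "h \<in> range scalar" for h :: "'n superspace"
      using that by (auto simp flip: scalar_minus)
    show "Units (superspace_ring\<lparr>carrier := range scalar\<rparr>) =
        range scalar - {\<zero>\<^bsub>superspace_ring :: 'n superspace ring\<^esub>}"
    proof (intro equalityI subsetI)
      fix x :: "'n superspace"
      assume x: "x \<in> range scalar - {\<zero>\<^bsub>superspace_ring\<^esub>}"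
      then obtain c where c: "x = scalar c" by blast
      with x have "c \<noteq> 0" by auto
      then have "scalar (inverse c) * x = 1" "x * scalar (inverse c) = 1"
        using c by (simp_all flip: scalar_mult)
      with x show "x \<in> Units (superspace_ring\<lparr>carrier := range scalar\<rparr>)"
        by (auto simp: Units_def)
    next
      fix x :: "'n superspace"
      assume "x \<in> Units (superspace_ring\<lparr>carrier := range scalar\<rparr>)"
      then have "x \<in> range scalar \<and> (\<exists>y. y * x = 1)" by (auto simp: Units_def)
      then show "x \<in> range scalar - {\<zero>\<^bsub>superspace_ring\<^esub>}" by auto
    qed
  qed (auto simp: mult.commute simp flip: scalar_mult scalar_add)
qed

text \<open>Ideal and kernel agree on the piece, so the images of a basis modulo the kernel are
  independent and span the image of the piece over the field of constants.\<close>

lemma quot_dim_eq_piece_dim: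
  fixes \<A> :: "(complex^'n::{finite,linorder}) set list"
  assumes m: "m = length \<A>" and a: "\<And>k. k < m \<Longrightarrow> \<A> ! k = {v. dot (a k) v = 0}"
  shows "quot_dim \<A> i j = piece_dim a m UNIV (int i) (int j)"
proof -
  let ?I = "super_ideal \<A>"
  let ?h = "quot_proj \<A>"
  let ?K = "?h ` range scalar"
  interpret ideal ?I superspace_ring by (rule ideal_super_ideal)
  interpret h: ring_hom_ring superspace_ring "super_quot \<A>" ?h
    unfolding super_quot_def by (rule rcos_ring_hom_ring)
  have h_eq_0: "?h f = \<zero>\<^bsub>super_quot \<A>\<^esub> \<longleftrightarrow> f \<in> ?I" for f
    using h.hom_zero a_rcos_self[of f] a_rcos_zero[OF ideal_super_ideal] a_rcos_const[of f]
    by (auto simp: super_quot_def FactRing_def)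
  have iff: "f \<in> ?I \<longleftrightarrow> f \<in> inverse_system_kernel a m" if "super_piece UNIV (int i) (int j) f" for i j f
    using super_ideal_iff_kernel[OF m a] that unfolding bidegree_part_eq_super_piece by simp
  have const: "inverse_system_kernel a m \<subseteq> {f. const_coeff f = 0}" by (induction m) auto
  \<comment> \<open>Elements of the kernel vanish at the origin, so the quotient is not the zero
    ring and the constants still form a field in it.\<close>
  have "(1 :: 'n superspace) \<notin> ?I"
  proof
    assume "1 \<in> ?I"
    then have "1 \<in> inverse_system_kernel a m" using super_ideal_subset_kernel[OF m a] by blast
    with const have "const_coeff (1 :: 'n superspace) = 0" by auto
    then show False by (metis const_coeff_scalar scalar_1 zero_neq_one)
  qed
  then have one: "\<one>\<^bsub>super_quot \<A>\<^esub> \<noteq> \<zero>\<^bsub>super_quot \<A>\<^esub>"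
    using h_eq_0[of 1] h.hom_one by simp
  have K: "subfield ?K (super_quot \<A>)"
    by (rule h.img_is_subfield(2)[OF subfield_range_scalar one])
  obtain bs where bs: "length bs = piece_dim a m UNIV (int i) (int j)"
      "basis_modulo (inverse_system_kernel a m) {f. super_piece UNIV (int i) (int j) f} bs"
    using basis_modulo_kernel[OF vec.subspace_UNIV] by blast
  have lin: "super_piece UNIV (int i) (int j) (lincomb cs bs)" for cs
    using basis_moduloD(1)[OF bs(2)] by (auto intro!: super_piece_lincomb)
  let ?us = "map ?h bs"
  have comb: "h.S.combine (map ?h (map scalar cs)) ?us = ?h (lincomb cs bs)" for cs
    using h.combine_hom[of "map scalar cs" bs] by (simp add: combine_superspace_ring del: map_map)
  have us: "set ?us \<subseteq> carrier (super_quot \<A>)" using h.hom_closed by auto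
  have "h.S.independent ?K ?us"
  proof (rule h.S.trivial_combine_imp_independent[OF K us])
    fix Ks
    assume Ks: "set Ks \<subseteq> ?K" "h.S.combine Ks ?us = \<zero>\<^bsub>super_quot \<A>\<^esub>"
    have carr: "set Ks \<subseteq> carrier (super_quot \<A>)"
      using Ks(1) subfieldE(3)[OF K] by (rule subset_trans)
    \<comment> \<open>The coefficient list may have any length, since \<open>combine\<close>
      truncates; it is replaced by one of the length of the basis, padded with zeros where
      necessary.\<close>
    obtain Ls where Ls: "set (take (length ?us) Ks) \<subseteq> set Ls"
        "set Ls \<subseteq> set (take (length ?us) Ks) \<union> {\<zero>\<^bsub>super_quot \<A>\<^esub>}" "length Ls = length ?us"
        "h.S.combine Ls ?us = h.S.combine Ks ?us"
      by (rule h.S.combine_normalize[OF carr us refl])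
    have "\<zero>\<^bsub>super_quot \<A>\<^esub> \<in> ?K"
      using h.hom_zero scalar_0 by (metis imageI rangeI superspace_ring_simps(4))
    then have "set Ls \<subseteq> ?K"
      using Ls(2) Ks(1) set_take_subset[of "length ?us" Ks] by blast
    then obtain cs where cs: "Ls = map (\<lambda>c. ?h (scalar c)) cs"
      using ex_map_conv[of Ls "\<lambda>c. ?h (scalar c)"] by auto
    have "?h (lincomb cs bs) = \<zero>\<^bsub>super_quot \<A>\<^esub>"
      using Ks(2) Ls(4) comb[of cs] cs by (simp add: comp_def)
    then have "lincomb cs bs \<in> inverse_system_kernel a m"
      using h_eq_0 iff lin by blast
    then have "set cs \<subseteq> {0}"
      using basis_moduloD(2)[OF bs(2)] Ls(3) cs by simp
    then have "set Ls \<subseteq> {\<zero>\<^bsub>super_quot \<A>\<^esub>}"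
      using h.hom_zero by (auto simp: cs)
    with Ls(1) show "set (take (length ?us) Ks) \<subseteq> {\<zero>\<^bsub>super_quot \<A>\<^esub>}" by blast
  qed
  moreover have "h.S.Span ?K ?us = ?h ` bidegree_part i j"
  proof -
    have "h.S.Span ?K ?us = {h.S.combine Ks ?us | Ks. length Ks = length ?us \<and> set Ks \<subseteq> ?K}"
      by (rule h.S.Span_eq_combine_set_length_version[OF K us])
    also have "\<dots> = {?h (lincomb cs bs) | cs. length cs = length bs}"
    proof (intro equalityI subsetI)
      fix x
      assume "x \<in> {h.S.combine Ks ?us | Ks. length Ks = length ?us \<and> set Ks \<subseteq> ?K}"
      then obtain Ks where Ks: "x = h.S.combine Ks ?us" "length Ks = length bs" "set Ks \<subseteq> ?K" by auto
      then obtain cs where "Ks = map (\<lambda>c. ?h (scalar c)) cs"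
        using ex_map_conv[of Ks "\<lambda>c. ?h (scalar c)"] by auto
      with Ks show "x \<in> {?h (lincomb cs bs) | cs. length cs = length bs}"
        using comb[of cs] by (auto simp: comp_def)
    next
      fix x
      assume "x \<in> {?h (lincomb cs bs) | cs. length cs = length bs}"
      then obtain cs where "x = ?h (lincomb cs bs)" "length cs = length bs" by auto
      then show "x \<in> {h.S.combine Ks ?us | Ks. length Ks = length ?us \<and> set Ks \<subseteq> ?K}"
        using comb[of cs] by (intro CollectI exI[of _ "map ?h (map scalar cs)"]) auto
    qed
    also have "\<dots> = ?h ` bidegree_part i j"
    proof (intro equalityI subsetI)
      fix x
      assume "x \<in> ?h ` bidegree_part i j"
      then obtain f where f: "x = ?h f" "super_piece UNIV (int i) (int j) f"
        by (auto simp: bidegree_part_eq_super_piece)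
      then obtain cs where cs: "length cs = length bs" "f - lincomb cs bs \<in> inverse_system_kernel a m"
        using basis_moduloD(3)[OF bs(2), of f] by auto
      then have "f - lincomb cs bs \<in> ?I"
        using iff[OF super_piece_diff[OF f(2) lin]] by blast
      then have "?h (f - lincomb cs bs) = \<zero>\<^bsub>super_quot \<A>\<^esub>" by (simp add: h_eq_0)
      moreover have "?h f = ?h (f - lincomb cs bs) \<oplus>\<^bsub>super_quot \<A>\<^esub> ?h (lincomb cs bs)"
        using h.hom_add[of "f - lincomb cs bs" "lincomb cs bs"] by simp
      ultimately have "x = ?h (lincomb cs bs)"
        using f(1) h.hom_closed[of "lincomb cs bs"] by simp
      with cs(1) show "x \<in> {?h (lincomb cs bs) | cs. length cs = length bs}" by blast
    qed (use lin in \<open>auto simp: bidegree_part_eq_super_piece\<close>)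
    finally show ?thesis .
  qed
  ultimately have "h.S.dimension (length ?us) ?K (?h ` bidegree_part i j)"
    using h.S.dimensionI[OF K] by blast
  then show ?thesis
    using h.S.dimI[OF K] bs(1) by (simp add: quot_dim_def over_def)
qed

section \<open>Ranks and the Tutte polynomial\<close>

text \<open>A linear map that kills a basis of \<open>S\<close> and fixes \<open>x\<close> exists; a
  row of its matrix at a nonzero coordinate of \<open>x\<close> is the desired form.\<close>

lemma separating_form:
  fixes x :: "complex^'n"
  assumes "vec.subspace S" "x \<notin> S"
  obtains v where "\<And>s. s \<in> S \<Longrightarrow> dot v s = 0" "dot v x \<noteq> 0"
proof -
  obtain B where B: "B \<subseteq> S" "vec.independent B" "S \<subseteq> vec.span B"
    using vec.maximal_independent_subset[of S] by blast
  have "vec.span B \<subseteq> S" using B(1) assms(1) by (rule vec.span_minimal)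
  then have "vec.independent (insert x B)"
    using assms(2) B by (intro vec.independent_insertI) auto
  then obtain g :: "complex^'n \<Rightarrow> complex^'n" where g: "Vector_Spaces.linear (*s) (*s) g"
      "\<And>y. y \<in> insert x B \<Longrightarrow> g y = (if y = x then x else 0)"
    using vec.linear_independent_extend[of "insert x B" "\<lambda>y. if y = x then x else 0"] by blast
  have "x \<notin> B" using assms(2) B(1) by auto
  then have "g b = 0" if "b \<in> B" for b using g(2)[of b] that by auto
  then have zero: "g s = 0" if "s \<in> S" for s
    using vec.linear_eq_0_on_span[OF g(1), of B s] B(3) that by auto
  have "x \<noteq> 0" using assms vec.subspace_0 by auto
  then obtain i where i: "x $ i \<noteq> 0" by (auto simp: vec_eq_iff)
  have "dot (matrix g $ i) y = (matrix g *v y) $ i" for y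
    by (simp add: dot_def matrix_vector_mult_def)
  then have "dot (matrix g $ i) y = g y $ i" for y
    by (simp only: matrix_works[OF g(1)])
  then show ?thesis
    using that[of "matrix g $ i"] zero g(2)[of x] i by auto
qed

lemma subspace_dot_kernel: "vec.subspace {v. dot a v = 0}"
  using subspace_Int_dot_kernel[OF vec.subspace_UNIV, of a] by simp

text \<open>A form separating \<open>H\<close> from an outside vector has a proper kernel containing
  \<open>H\<close>, and equality follows by dimension. Hence the choice in
  \<open>normal_form\<close> has a witness.\<close>

lemma hyperplane_normal_form:
  fixes H :: "(complex^'n) set"
  assumes "hyperplane H"
  shows "H = {v. dot (normal_form H) v = 0}"
proof -
  have H: "vec.subspace H" "vec.dim H + 1 = CARD('n)" using assms by (auto simp: hyperplane_def)
  have "H \<noteq> UNIV" using H(2) vec_dim_card[where 'a=complex and 'n='n] by auto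
  then obtain x where "x \<notin> H" by auto
  then obtain \<alpha> where \<alpha>: "\<And>s. s \<in> H \<Longrightarrow> dot \<alpha> s = 0" "dot \<alpha> x \<noteq> 0"
    using separating_form[OF H(1)] by metis
  have "{v. dot \<alpha> v = 0} \<noteq> UNIV" using \<alpha>(2) by auto
  then have "vec.dim {v. dot \<alpha> v = 0} \<noteq> CARD('n)"
    using vec.subspace_dim_equal[OF subspace_dot_kernel vec.subspace_UNIV subset_UNIV, of \<alpha>]
    by (auto simp: card_cart_basis)
  moreover have "vec.dim {v. dot \<alpha> v = 0} \<le> CARD('n)"
    by (rule dim_subset_UNIV_cart_gen)
  ultimately have "vec.dim {v. dot \<alpha> v = 0} \<le> vec.dim H" using H(2) by simp
  then have "H = {v. dot \<alpha> v = 0}"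
    using \<alpha>(1) H(1) subspace_dot_kernel by (intro vec.subspace_dim_equal) auto
  moreover have "\<alpha> \<noteq> 0" using \<alpha>(2) by (auto simp: dot_def)
  ultimately have "\<alpha> \<noteq> 0 \<and> H = {v. (\<Sum>i\<in>UNIV. \<alpha> $ i * v $ i) = 0}" by (simp add: dot_def)
  then have "normal_form H \<noteq> 0 \<and> H = {v. (\<Sum>i\<in>UNIV. normal_form H $ i * v $ i) = 0}"
    unfolding normal_form_def by (rule someI)
  then show ?thesis by (simp add: dot_def)
qed

text \<open>Subtracting a suitable multiple of \<open>u\<close> moves any vector of \<open>U\<close>
  into the kernel, so \<open>u\<close> together with the kernel spans \<open>U\<close>.\<close>

lemma dim_Int_dot_kernel:
  assumes "vec.subspace U" "u \<in> U" "dot a u \<noteq> 0"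
  shows "vec.dim U = Suc (vec.dim (U \<inter> {v. dot a v = 0}))"
proof -
  let ?H = "U \<inter> {v. dot a v = 0}"
  have H: "vec.subspace ?H" by (rule subspace_Int_dot_kernel[OF assms(1)])
  have "U = vec.span (insert u ?H)"
  proof (intro equalityI subsetI)
    fix v
    assume v: "v \<in> U"
    let ?c = "dot a v / dot a u"
    have "v - ?c *s u \<in> ?H"
      using assms v by (auto simp: dot_diff_right dot_scale_right vec.subspace_diff vec.subspace_scale)
    then have "v - ?c *s u \<in> vec.span (insert u ?H)" by (intro vec.span_base) simp
    moreover have "?c *s u \<in> vec.span (insert u ?H)"
      by (intro vec.span_scale vec.span_base) simp
    ultimately have "(v - ?c *s u) + ?c *s u \<in> vec.span (insert u ?H)" by (rule vec.span_add)
    then show "v \<in> vec.span (insert u ?H)" by simp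
  next
    fix v
    assume "v \<in> vec.span (insert u ?H)"
    moreover have "vec.span (insert u ?H) \<subseteq> U"
      using assms by (intro vec.span_minimal) auto
    ultimately show "v \<in> U" by blast
  qed
  moreover have "u \<notin> vec.span ?H"
    using assms(3) H by (simp add: vec.span_eq_iff[THEN iffD2])
  ultimately show ?thesis
    by (metis Suc_eq_plus1 vec.dim_insert vec.dim_span)
qed

text \<open>Rank-nullity, one form at a time: a form in the span of the others leaves the common
  zero set unchanged, and any other form lowers its dimension by one.\<close>

lemma dim_forms_kernel:
  fixes a :: "nat \<Rightarrow> complex^'n"
  assumes "finite S"
  shows "vec.dim (vec.span (a ` S)) + vec.dim {v. \<forall>k\<in>S. dot (a k) v = 0} = CARD('n)"
  using assms
proof (induction S)
  case empty
  then show ?case by (simp add: card_cart_basis)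
next
  case (insert k S)
  let ?N = "{v. \<forall>k\<in>S. dot (a k) v = 0}"
  have N: "vec.subspace ?N"
    by (auto simp: vec.subspace_def dot_add_right dot_scale_right)
  have ins: "{v. \<forall>k\<in>insert k S. dot (a k) v = 0} = ?N \<inter> {v. dot (a k) v = 0}" by auto
  show ?case
  proof (cases "a k \<in> vec.span (a ` S)")
    case True
    have "dot (a k) v = 0" if "v \<in> ?N" for v
    proof -
      have "vec.span (a ` S) \<subseteq> {w. dot v w = 0}"
        using that by (intro vec.span_minimal subspace_dot_kernel) (auto simp: dot_commute)
      with True show ?thesis by (auto simp: dot_commute)
    qed
    then have "{v. \<forall>k\<in>insert k S. dot (a k) v = 0} = ?N" by auto
    with True insert.IH show ?thesis by (simp add: vec.span_redundant)
  next
    case False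
    \<comment> \<open>By the symmetry of \<open>dot\<close>, a vector separating \<open>a k\<close>
      from the span is a common zero of the old forms at which the new one does not vanish.\<close>
    obtain v where v: "\<And>s. s \<in> vec.span (a ` S) \<Longrightarrow> dot v s = 0" "dot v (a k) \<noteq> 0"
      using separating_form[OF vec.subspace_span False] by metis
    have "dot (a j) v = 0" if "j \<in> S" for j
      using v(1)[OF vec.span_base, of "a j"] that by (simp add: dot_commute)
    then have "v \<in> ?N" "dot (a k) v \<noteq> 0"
      using v(2) by (simp_all add: dot_commute[of v])
    then have "vec.dim ?N = Suc (vec.dim (?N \<inter> {v. dot (a k) v = 0}))"
      by (rule dim_Int_dot_kernel[OF N])
    moreover have "vec.dim (vec.span (a ` insert k S)) = Suc (vec.dim (vec.span (a ` S)))"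
      using False by (simp add: vec.dim_insert)
    ultimately show ?thesis using insert.IH unfolding ins by simp
  qed
qed

text \<open>The rank of the forms restricted to \<open>U\<close>, expressed as the codimension in
  \<open>U\<close> of their common zero set. This avoids dual spaces and adapts directly to passing
  to a hyperplane of \<open>U\<close>.\<close>

definition rank_on :: "(nat \<Rightarrow> complex^'n) \<Rightarrow> (complex^'n) set \<Rightarrow> nat set \<Rightarrow> nat" where
  "rank_on a U S = vec.dim U - vec.dim (U \<inter> {v. \<forall>k\<in>S. dot (a k) v = 0})"

lemma rank_on_UNIV:
  "finite S \<Longrightarrow> rank_on a UNIV S = vec.dim (vec.span (a ` S))"
  using dim_forms_kernel[of S a] by (simp add: rank_on_def card_cart_basis)

lemma rank_on_insert_loop:
  assumes "\<forall>v\<in>U. dot (a m) v = 0"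
  shows "rank_on a U (insert m S) = rank_on a U S"
proof -
  have "U \<inter> {v. \<forall>k\<in>insert m S. dot (a k) v = 0} = U \<inter> {v. \<forall>k\<in>S. dot (a k) v = 0}"
    using assms by auto
  then show ?thesis by (simp add: rank_on_def)
qed

lemma rank_on_insert:
  assumes "vec.subspace U" "\<not> (\<forall>v\<in>U. dot (a m) v = 0)"
  shows "rank_on a U (insert m S) = Suc (rank_on a (U \<inter> {v. dot (a m) v = 0}) S)"
proof -
  let ?H = "U \<inter> {v. dot (a m) v = 0}"
  have "U \<inter> {v. \<forall>k\<in>insert m S. dot (a k) v = 0} = ?H \<inter> {v. \<forall>k\<in>S. dot (a k) v = 0}" by auto
  moreover have "vec.dim U = Suc (vec.dim ?H)" using assms dim_Int_dot_kernel by blast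
  moreover have "vec.dim (?H \<inter> {v. \<forall>k\<in>S. dot (a k) v = 0}) \<le> vec.dim ?H"
    by (rule vec.dim_subset) auto
  ultimately show ?thesis unfolding rank_on_def by simp
qed

text \<open>Each form lowers the dimension by at most one. The bound makes the truncated exponent
  \<open>card S - rank_on a U S\<close> a true difference.\<close>

lemma rank_on_le_card:
  assumes "finite S" "vec.subspace U"
  shows "rank_on a U S \<le> card S"
  using assms
proof (induction S arbitrary: U)
  case (insert k S)
  then show ?case
    using rank_on_insert_loop[of U a k S] rank_on_insert[of U a k S]
      insert.IH[of U] insert.IH[OF subspace_Int_dot_kernel[of U "a k"]]
    by (cases "\<forall>v\<in>U. dot (a k) v = 0") (simp_all add: le_SucI)
qed (simp add: rank_on_def)

section \<open>Generating series and their expansion over subsets\<close>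

primrec piece_series :: "(nat \<Rightarrow> complex^'n) \<Rightarrow> nat \<Rightarrow> (complex^'n) set \<Rightarrow> laurent_qt" where
  "piece_series a 0 U = 1"
| "piece_series a (Suc m) U = (if \<forall>v\<in>U. dot (a m) v = 0 then piece_series a m U
     else var_q * piece_series a m U + (1 + var_t) * piece_series a m (U \<inter> {v. dot (a m) v = 0}))"

text \<open>Multiplication by \<open>var_q\<close> or \<open>var_t\<close> shifts the corresponding
  index, and Laurent coefficients have integer indices, just like the degrees of
  \<open>piece_dim\<close>.\<close>

lemma piece_series_nth: "fls_nth (fls_nth (piece_series a m U) i) j = of_nat (piece_dim a m U i j)"
proof (induction m arbitrary: U i j)
  case (Suc m)
  have q: "fls_nth (var_q * f) i = fls_nth f (i - 1)" for f :: laurent_qt and i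
    by (simp add: var_q_def fls_X_times_conv_shift)
  have t: "fls_nth (fls_nth (var_t * f) i) j = fls_nth (fls_nth f i) (j - 1)" for f :: laurent_qt and i j
    by (simp add: var_t_def fls_X_times_conv_shift)
  show ?case by (simp add: distrib_right q t Suc.IH)
qed simp

lemma sum_Pow_insert:
  assumes "finite A" "x \<notin> A"
  shows "sum f (Pow (insert x A)) = (\<Sum>S\<in>Pow A. f S + f (insert x S))"
proof -
  have "sum f (Pow (insert x A)) = sum f (Pow A) + sum f (insert x ` Pow A)"
    unfolding Pow_insert using assms by (intro sum.union_disjoint) auto
  also have "sum f (insert x ` Pow A) = (\<Sum>S\<in>Pow A. f (insert x S))"
    using assms(2) by (subst sum.reindex) (auto simp: inj_on_def)
  finally show ?thesis by (simp add: sum.distrib)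
qed

text \<open>Subsets are split by whether they contain the new index \<open>m\<close>. Those without
  it gain a factor \<open>var_q\<close>. Those with it gain \<open>1 - var_q\<close> if form
  \<open>m\<close> vanishes on \<open>U\<close>, so that the two factors add up to \<open>1\<close>;
  otherwise they gain \<open>1 + var_t\<close> and their rank is taken on the hyperplane.\<close>

lemma piece_series_eq_sum:
  assumes "vec.subspace U"
  shows "piece_series a m U = (\<Sum>S\<in>Pow {..<m}. (1 + var_t) ^ rank_on a U S *
    var_q ^ (m - card S) * (1 - var_q) ^ (card S - rank_on a U S))"
  using assms
proof (induction m arbitrary: U)
  case 0
  then show ?case by (simp add: rank_on_def)
next
  case (Suc m)
  let ?f = "\<lambda>m U S. (1 + var_t) ^ rank_on a U S * var_q ^ (m - card S) *
    (1 - var_q) ^ (card S - rank_on a U S)"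
  have S: "finite S" "card S \<le> m" "m \<notin> S" if "S \<in> Pow {..<m}" for S
    using that finite_subset[of S "{..<m}"] card_mono[of "{..<m}" S] by auto
  have del: "?f (Suc m) U S = var_q * ?f m U S" if "S \<in> Pow {..<m}" for S
    using S(2)[OF that] by (simp add: Suc_diff_le)
  have "sum (?f (Suc m) U) (Pow {..<Suc m}) =
      (\<Sum>S\<in>Pow {..<m}. ?f (Suc m) U S + ?f (Suc m) U (insert m S))"
    unfolding lessThan_Suc by (rule sum_Pow_insert) auto
  also have "\<dots> = piece_series a (Suc m) U"
  proof (cases "\<forall>v\<in>U. dot (a m) v = 0")
    case True
    have "?f (Suc m) U (insert m S) = (1 - var_q) * ?f m U S" if "S \<in> Pow {..<m}" for S
      using S[OF that] rank_on_le_card[OF S(1)[OF that] Suc.prems, of a]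
      by (simp add: rank_on_insert_loop[of U a m, OF True] Suc_diff_le)
    then have "(\<Sum>S\<in>Pow {..<m}. ?f (Suc m) U S + ?f (Suc m) U (insert m S)) =
        (\<Sum>S\<in>Pow {..<m}. ?f m U S)"
      using del by (intro sum.cong refl) (simp only:, simp add: algebra_simps)
    with True show ?thesis by (simp add: Suc.IH[OF Suc.prems])
  next
    case False
    let ?H = "U \<inter> {v. dot (a m) v = 0}"
    have "?f (Suc m) U (insert m S) = (1 + var_t) * ?f m ?H S" if "S \<in> Pow {..<m}" for S
      using S[OF that] by (simp add: rank_on_insert[of U a m, OF Suc.prems False])
    then have "(\<Sum>S\<in>Pow {..<m}. ?f (Suc m) U S + ?f (Suc m) U (insert m S)) =
        var_q * (\<Sum>S\<in>Pow {..<m}. ?f m U S) + (1 + var_t) * (\<Sum>S\<in>Pow {..<m}. ?f m ?H S)"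
      unfolding sum_distrib_left sum.distrib[symmetric] using del by (intro sum.cong refl) simp
    with False show ?thesis
      by (simp only: piece_series.simps if_False Suc.IH[OF Suc.prems]
          Suc.IH[OF subspace_Int_dot_kernel[OF Suc.prems]])
  qed
  finally show ?case by simp
qed

text \<open>At these arguments \<open>x - 1\<close> is \<open>var_q / (1 + var_t)\<close> and
  \<open>y - 1\<close> is \<open>(1 - var_q) / var_q\<close>; the prefactor clears all
  denominators.\<close>

lemma tutte_eq_sum:
  fixes \<A> :: "(complex^'n) set list"
  defines "r \<equiv> arr_rank \<A>" and "m \<equiv> length \<A>"
  shows "(1 + var_t) ^ r * var_q ^ (m - r) *
      tutte \<A> ((1 + var_q + var_t) / (1 + var_t)) (1 / var_q) =
    (\<Sum>S\<in>Pow {..<m}. (1 + var_t) ^ subrank \<A> S * var_q ^ (m - card S) *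
      (1 - var_q) ^ (card S - subrank \<A> S))"
proof -
  have q: "var_q \<noteq> 0" by (simp add: var_q_def)
  have t: "1 + var_t \<noteq> 0"
  proof
    assume "1 + var_t = 0"
    then have "fls_nth (fls_nth (1 + var_t) 0) 0 = (0 :: rat)" by simp
    then show False by (simp add: var_t_def)
  qed
  have "(1 + var_q + var_t) / (1 + var_t) - 1 = var_q / (1 + var_t)"
    "1 / var_q - 1 = (1 - var_q) / var_q"
    using q t by (simp_all add: field_simps)
  then have "tutte \<A> ((1 + var_q + var_t) / (1 + var_t)) (1 / var_q) =
      (\<Sum>S\<in>Pow {..<m}. (var_q / (1 + var_t)) ^ (r - subrank \<A> S) *
        ((1 - var_q) / var_q) ^ (card S - subrank \<A> S))"
    by (simp only: tutte_def r_def m_def)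
  moreover have "(1 + var_t) ^ r * var_q ^ (m - r) * ((var_q / (1 + var_t)) ^ (r - subrank \<A> S) *
        ((1 - var_q) / var_q) ^ (card S - subrank \<A> S)) =
      (1 + var_t) ^ subrank \<A> S * var_q ^ (m - card S) * (1 - var_q) ^ (card S - subrank \<A> S)"
    if "S \<in> Pow {..<m}" for S
  proof -
    have le_card: "subrank \<A> T \<le> card T" if "finite T" for T
      unfolding subrank_def
      using that vec.dim_le_card'[of "(\<lambda>k. normal_form (\<A> ! k)) ` T"]
        card_image_le[of T "\<lambda>k. normal_form (\<A> ! k)"] by simp
    have fin: "finite S" "card S \<le> m"
      using that finite_subset[of S "{..<m}"] card_mono[of "{..<m}" S] by auto
    have "subrank \<A> S \<le> r" "r \<le> m"
      using that le_card[of "{..<m}"]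
      by (auto simp: r_def arr_rank_def subrank_def m_def intro!: vec.dim_subset vec.span_mono)
    moreover note le_card[OF fin(1)] fin(2)
    \<comment> \<open>Corank, nullity and the excess of the size over the full rank. They turn every
      truncated difference into a sum, and \<open>n \<le> p + l\<close> guarantees that the power of
      \<open>var_q\<close> left over is not negative.\<close>
    moreover define p n l where "p = r - subrank \<A> S" "n = card S - subrank \<A> S" "l = m - r"
    ultimately have e: "r = subrank \<A> S + p" "card S = subrank \<A> S + n"
        "m = subrank \<A> S + p + l" and n: "n \<le> p + l"
      by auto
    have "m - card S = p + l - n" using e by simp
    moreover have "var_q ^ (p + l) = var_q ^ (p + l - n) * var_q ^ n"
      using n by (simp flip: power_add)
    ultimately show ?thesis
      using q t e by (simp add: power_add power_divide field_simps)
  qed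
  ultimately show ?thesis by (simp add: sum_distrib_left)
qed

lemma hilb_nth: "fls_nth (fls_nth (hilb dims) i) j = (if 0 \<le> i \<and> 0 \<le> j then of_nat (dims (nat i) (nat j)) else 0)"
  by (simp add: hilb_def)

lemma piece_dim_negative: "i < 0 \<or> j < 0 \<Longrightarrow> piece_dim a m U i j = 0"
  by (induction m arbitrary: U i j) auto

theorem theorem1p1:
  fixes \<A> :: "(complex^'n::{finite,linorder}) set list" and r m :: nat
  assumes "multiarrangement \<A>" and "r = arr_rank \<A>" and "m = length \<A>"
  shows "hilb (quot_dim \<A>) =
    (1 + var_t) ^ r * var_q ^ (m - r) * tutte \<A> ((1 + var_q + var_t) / (1 + var_t)) (1 / var_q)"
proof -
  let ?a = "\<lambda>k. normal_form (\<A> ! k)"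
  have "\<A> ! k = {v. dot (?a k) v = 0}" if "k < m" for k
    using assms(1,3) that by (intro hyperplane_normal_form) (simp add: multiarrangement_def)
  then have "quot_dim \<A> i j = piece_dim ?a m UNIV (int i) (int j)" for i j
    using quot_dim_eq_piece_dim[of m \<A> ?a] assms(3) by blast
  \<comment> \<open>Coefficients are compared at all integer indices; at negative ones both sides
    are \<open>0\<close>.\<close>
  then have "hilb (quot_dim \<A>) = piece_series ?a m UNIV"
    by (intro fls_eqI) (auto simp: hilb_nth piece_series_nth piece_dim_negative)
  also have "\<dots> = (\<Sum>S\<in>Pow {..<m}. (1 + var_t) ^ subrank \<A> S * var_q ^ (m - card S) *
      (1 - var_q) ^ (card S - subrank \<A> S))"
  proof -
    have "rank_on ?a UNIV S = subrank \<A> S" if "S \<in> Pow {..<m}" for S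
      using that finite_subset[of S "{..<m}"] by (simp add: rank_on_UNIV subrank_def)
    then show ?thesis
      unfolding piece_series_eq_sum[OF vec.subspace_UNIV] by (intro sum.cong refl) simp
  qed
  also have "\<dots> = (1 + var_t) ^ r * var_q ^ (m - r) *
      tutte \<A> ((1 + var_q + var_t) / (1 + var_t)) (1 / var_q)"
    unfolding assms(2,3) by (rule tutte_eq_sum[symmetric])
  finally show ?thesis .
qed

end
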